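(* Let $M$ be a compact complex manifold and let $\mathcal{F}$ be a (non-singular) holomorphic foliation in $M$, of any codimension. Let $\Omega(\mathcal{F})\subset M$ be the union of all compact leaves of $\mathcal{F}$. Then $\mathcal{F}$ has a compact stable leaf if and only if $\Omega(\mathcal{F})$ has positive measure in $M$.
   Context: A subset $X$ of a differentiable $m$-manifold $M$ has zero measure if $M$ admits an open cover by coordinate charts $\varphi:U\subset M\to\varphi(U)\subset\mathbb{R}^m$ such that $\varphi(U\cap X)$ has zero Lebesgue measure in $\mathbb{R}^m$; otherwise $X$ is said to have positive measure. A compact leaf $L$ of $\mathcal{F}$ is called stable if its holonomy group $\operatorname{Hol}(\mathcal{F},L)$ (a group of germs at a point of a transverse disc to $L$) is finite. *)

theory Defs
  imports "HOL-Analysis.Analysis"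
begin

section \<open>Holomorphic maps in several variables\<close>

definition cn_holomorphic_on :: "(complex^'n \<Rightarrow> complex^'m) \<Rightarrow> (complex^'n) set \<Rightarrow> bool"
    (infix \<open>cn'_holomorphic'_on\<close> 50) where
  "f cn_holomorphic_on S \<longleftrightarrow>
     (\<forall>z\<in>S. \<exists>D. (f has_derivative D) (at z) \<and> (\<forall>a v. D (a *s v) = a *s D v))"


section \<open>Complex manifolds\<close>

text \<open>A manifold is a topology together with an atlas; a chart is a pair of its domain and its
  coordinate map (the values of the latter outside the domain are irrelevant).  The complex
  dimension is the cardinality of \<open>'n\<close>, and \<open>complex^'n\<close> is a Euclidean space of real dimension
  twice that number.\<close>

type_synonym ('a, 'n) chart = "'a set \<times> ('a \<Rightarrow> complex^'n)"

definition is_chart :: "'a topology \<Rightarrow> ('a, 'n::finite) chart \<Rightarrow> bool" where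
  "is_chart X = (\<lambda>(U, \<phi>). openin X U \<and> open (\<phi> ` U) \<and>
     homeomorphic_map (subtopology X U) (top_of_set (\<phi> ` U)) \<phi>)"

definition overlap :: "('a, 'n::finite) chart \<Rightarrow> ('a, 'n) chart \<Rightarrow> (complex^'n) set" where
  "overlap c d = snd c ` (fst c \<inter> fst d)"

definition transition :: "('a, 'n::finite) chart \<Rightarrow> ('a, 'n) chart \<Rightarrow> complex^'n \<Rightarrow> complex^'n" where
  "transition c d = snd d \<circ> inv_into (fst c) (snd c)"

definition holo_compatible :: "('a, 'n::finite) chart \<Rightarrow> ('a, 'n) chart \<Rightarrow> bool" where
  "holo_compatible c d \<longleftrightarrow>
     transition c d cn_holomorphic_on overlap c d \<and>
     transition d c cn_holomorphic_on overlap d c"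

definition complex_manifold :: "'a topology \<Rightarrow> ('a, 'n::finite) chart set \<Rightarrow> bool" where
  "complex_manifold X A \<longleftrightarrow>
     Hausdorff_space X \<and> second_countable X \<and>
     (\<forall>c\<in>A. is_chart X c) \<and> \<Union> (fst ` A) = topspace X \<and>
     (\<forall>c\<in>A. \<forall>d\<in>A. holo_compatible c d)"

text \<open>The coordinate charts of the manifold, i.e. the members of the maximal atlas.\<close>

definition coordinate_chart ::
  "'a topology \<Rightarrow> ('a, 'n::finite) chart set \<Rightarrow> ('a, 'n) chart \<Rightarrow> bool" where
  "coordinate_chart X A c \<longleftrightarrow> is_chart X c \<and> (\<forall>d\<in>A. holo_compatible c d)"

definition zero_measure :: "'a topology \<Rightarrow> ('a, 'n::finite) chart set \<Rightarrow> 'a set \<Rightarrow> bool" where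
  "zero_measure X A S \<longleftrightarrow>
     (\<exists>C. (\<forall>c\<in>C. coordinate_chart X A c) \<and> \<Union> (fst ` C) = topspace X \<and>
          (\<forall>(U, \<phi>)\<in>C. \<phi> ` (U \<inter> S) \<in> null_sets lebesgue))"

abbreviation positive_measure :: "'a topology \<Rightarrow> ('a, 'n::finite) chart set \<Rightarrow> 'a set \<Rightarrow> bool" where
  "positive_measure X A S \<equiv> \<not> zero_measure X A S"


section \<open>Holomorphic foliations\<close>

text \<open>A foliation is given by an atlas \<open>F\<close> of foliated charts onto polydiscs.  The set \<open>J\<close> consists
  of the indices of the transverse coordinates, so the codimension is \<open>card J\<close>; it may take any
  value from 0 to the dimension.  The plaques of a foliated chart are the sets on which all
  coordinates with index in \<open>J\<close> are constant.  Changes of foliated charts map plaques to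
  plaques only locally, because the intersection of two plaques need not be connected.\<close>

definition polydisc :: "complex^'n \<Rightarrow> ('n \<Rightarrow> real) \<Rightarrow> (complex^'n) set" where
  "polydisc a r = {z. \<forall>i. dist (z $ i) (a $ i) < r i}"

definition agree_on :: "'n set \<Rightarrow> complex^'n \<Rightarrow> complex^'n \<Rightarrow> bool" where
  "agree_on J z w \<longleftrightarrow> (\<forall>i\<in>J. z $ i = w $ i)"

definition preserves_plaques :: "'n::finite set \<Rightarrow> ('a, 'n) chart \<Rightarrow> ('a, 'n) chart \<Rightarrow> bool" where
  "preserves_plaques J c d \<longleftrightarrow>
     (\<forall>z \<in> overlap c d. \<exists>W. open W \<and> z \<in> W \<and> W \<subseteq> overlap c d \<and>
        (\<forall>z1\<in>W. \<forall>z2\<in>W. agree_on J z1 z2 \<longrightarrow>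
           agree_on J (transition c d z1) (transition c d z2)))"

definition holomorphic_foliation ::
  "'a topology \<Rightarrow> ('a, 'n::finite) chart set \<Rightarrow> 'n set \<Rightarrow> ('a, 'n) chart set \<Rightarrow> bool" where
  "holomorphic_foliation X A J F \<longleftrightarrow>
     (\<forall>c\<in>F. coordinate_chart X A c \<and> (\<exists>a r. (\<forall>i. r i > 0) \<and> snd c ` fst c = polydisc a r)) \<and>
     \<Union> (fst ` F) = topspace X \<and>
     (\<forall>c\<in>F. \<forall>d\<in>F. preserves_plaques J c d)"

definition same_plaque :: "'n::finite set \<Rightarrow> ('a, 'n) chart \<Rightarrow> 'a \<Rightarrow> 'a \<Rightarrow> bool" where
  "same_plaque J c x y \<longleftrightarrow> x \<in> fst c \<and> y \<in> fst c \<and> agree_on J (snd c x) (snd c y)"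

text \<open>The leaf topology is generated by the (relatively) open subsets of plaques.  The leaves are its
  connected components, and a leaf is compact if it is so in its intrinsic topology.\<close>

definition leaf_topology :: "'a topology \<Rightarrow> 'n::finite set \<Rightarrow> ('a, 'n) chart set \<Rightarrow> 'a topology" where
  "leaf_topology X J F =
     topology_generated_by {W \<inter> {y. same_plaque J c x y} | W c x. openin X W \<and> c \<in> F}"

definition leaves :: "'a topology \<Rightarrow> 'n::finite set \<Rightarrow> ('a, 'n) chart set \<Rightarrow> 'a set set" where
  "leaves X J F = connected_components_of (leaf_topology X J F)"

definition compact_leaf ::
  "'a topology \<Rightarrow> 'n::finite set \<Rightarrow> ('a, 'n) chart set \<Rightarrow> 'a set \<Rightarrow> bool" where
  "compact_leaf X J F L \<longleftrightarrow> L \<in> leaves X J F \<and> compactin (leaf_topology X J F) L"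

definition compact_leaves_union ::
  "'a topology \<Rightarrow> 'n::finite set \<Rightarrow> ('a, 'n) chart set \<Rightarrow> 'a set" (\<open>\<Omega>\<close>) where
  "\<Omega> X J F = \<Union> {L. compact_leaf X J F L}"


section \<open>Holonomy\<close>

text \<open>As transverse discs through a point we take the slices of foliated charts on which all
  coordinates along the leaves are constant.\<close>

definition transverse_disc :: "'n::finite set \<Rightarrow> ('a, 'n) chart \<Rightarrow> 'a \<Rightarrow> 'a set" where
  "transverse_disc J c x = {y \<in> fst c. agree_on (- J) (snd c x) (snd c y)}"

definition transverse_disc_at ::
  "'n::finite set \<Rightarrow> ('a, 'n) chart set \<Rightarrow> 'a \<Rightarrow> 'a set \<Rightarrow> bool" where
  "transverse_disc_at J F x D \<longleftrightarrow> (\<exists>c\<in>F. x \<in> fst c \<and> D = transverse_disc J c x)"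

text \<open>The map \<open>f\<close> represents the germ from \<open>(D, x)\<close> to \<open>(E, y)\<close> that slides points along the plaques
  of the chart \<open>c\<close>.\<close>

definition plaque_holonomy ::
  "'a topology \<Rightarrow> 'n::finite set \<Rightarrow> ('a, 'n) chart \<Rightarrow>
   'a set \<Rightarrow> 'a \<Rightarrow> 'a set \<Rightarrow> 'a \<Rightarrow> ('a \<Rightarrow> 'a) \<Rightarrow> bool" where
  "plaque_holonomy X J c D x E y f \<longleftrightarrow>
     f x = y \<and>
     (\<exists>W. openin X W \<and> x \<in> W \<and>
        continuous_map (subtopology X (W \<inter> D)) (subtopology X E) f \<and>
        (\<forall>p \<in> W \<inter> D. same_plaque J c p (f p)))"

text \<open>\<open>h\<close> represents the holonomy of the leafwise path \<open>\<gamma>\<close> from the transverse disc \<open>D\<close> to \<open>E\<close>: cut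
  \<open>\<gamma>\<close> into \<open>k\<close> pieces lying in foliated charts \<open>c j\<close>, choose transverse discs \<open>T j\<close> at the
  division points, and compose the maps \<open>f j\<close> that slide along the plaques of \<open>c j\<close>.\<close>

definition holonomy_along ::
  "'a topology \<Rightarrow> 'n::finite set \<Rightarrow> ('a, 'n) chart set \<Rightarrow>
   (real \<Rightarrow> 'a) \<Rightarrow> 'a set \<Rightarrow> 'a set \<Rightarrow> ('a \<Rightarrow> 'a) \<Rightarrow> bool" where
  "holonomy_along X J F \<gamma> D E h \<longleftrightarrow>
     (\<exists>(k::nat) t c T f.
        t 0 = 0 \<and> t k = 1 \<and> T 0 = D \<and> T k = E \<and>
        (\<forall>j\<le>k. transverse_disc_at J F (\<gamma> (t j)) (T j)) \<and>
        (\<forall>j<k. t j < t (Suc j) \<and> c j \<in> F \<and> \<gamma> ` {t j..t (Suc j)} \<subseteq> fst (c j) \<and>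
           plaque_holonomy X J (c j) (T j) (\<gamma> (t j)) (T (Suc j)) (\<gamma> (t (Suc j))) (f j)) \<and>
        h = fold (\<lambda>j g. f j \<circ> g) [0..<k] id)"

definition germ :: "'a topology \<Rightarrow> 'a set \<Rightarrow> 'a \<Rightarrow> ('a \<Rightarrow> 'a) \<Rightarrow> ('a \<Rightarrow> 'a) set" where
  "germ X D x h = {g. \<exists>W. openin X W \<and> x \<in> W \<and> (\<forall>y \<in> W \<inter> D. g y = h y)}"

text \<open>The underlying set of the holonomy group at \<open>x\<close> (under composition of germs) of the leaf
  through \<open>x\<close>.  Other base points in the leaf and other transverse discs yield conjugate groups,
  so finiteness does not depend on them.\<close>

definition holonomy_group ::
  "'a topology \<Rightarrow> 'n::finite set \<Rightarrow> ('a, 'n) chart set \<Rightarrow> 'a set \<Rightarrow> 'a \<Rightarrow> ('a \<Rightarrow> 'a) set set" where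
  "holonomy_group X J F D x =
     {germ X D x h | \<gamma> h. pathin (leaf_topology X J F) \<gamma> \<and> \<gamma> 0 = x \<and> \<gamma> 1 = x \<and>
        holonomy_along X J F \<gamma> D D h}"

definition stable_leaf ::
  "'a topology \<Rightarrow> 'n::finite set \<Rightarrow> ('a, 'n) chart set \<Rightarrow> 'a set \<Rightarrow> bool" where
  "stable_leaf X J F L \<longleftrightarrow>
     (\<exists>x\<in>L. \<exists>D. transverse_disc_at J F x D \<and> finite (holonomy_group X J F D x))"

end

theory Submission
  imports Defs "HOL-Complex_Analysis.Complex_Analysis"
begin

text \<open>Positive measure gives stability: in some foliated chart, the points whose (compact) leaf meets a
  ball in at most \<open>n\<close> plaques form a set that is not negligible near one of its points \<open>p\<close>.  For
  \<open>n + 1\<close> distinct holonomy germs at \<open>p\<close>, each point of this set near \<open>p\<close> has two equal images by the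
  pigeonhole principle.  So two of the germs agree on a set that is not negligible, and by the
  identity theorem they coincide; hence the holonomy group has at most \<open>n\<close> elements.

  Conversely, if the holonomy of a compact leaf is finite, then the leaves through nearby points are
  compact by Reeb's argument: each of them is a finite union of plaques, which are found by sliding
  the point along representatives of the finitely many holonomy germs to a finite cover of the
  leaf.\<close>

section \<open>Zero sets of holomorphic maps\<close>

text \<open>Measurability of \<open>\<Omega> X J F\<close> is nowhere established, and a set that is
  not null need not be measurable. Density points are therefore replaced by points all of whose
  neighbourhoods meet the set in a non-negligible set; negligibility passes to countable unions and
  subsets without measurability. Accordingly the identity theorem takes the form that the zero set
  of a holomorphic map on a polydisc is negligible unless the map vanishes identically.

  The transverse space has dimension \<open>card J\<close>, which is not the cardinality of a fixed
  type. Functions on a transverse disc are instead extended to an open subset of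
  \<open>complex^'n\<close> as functions independent of the leafwise coordinates, and measures are
  taken in full dimension.

  In Reeb's argument the danger is that infinitely many paths lead from the base point to a given
  centre, each with its own domain of holonomy. Finite holonomy makes the germs along them finite in
  number, so that one neighbourhood serves all the chosen representatives.\<close>

text \<open>By translation invariance the measure of \<open>E\<close> is the average over
  \<open>t\<close> in [0,1] of the integrals of the indicator at \<open>x + t *\<^sub>R b\<close>.
  Exchanging the integrals leaves, for each \<open>x\<close>, the length of a countable set of
  times, which is 0. Averaging translates avoids splitting the space into a line and a
  complement.\<close>

lemma lborel_null_if_countable_on_lines:
  fixes E :: "'a::euclidean_space set" and b :: 'a
  assumes E: "E \<in> sets borel" and lines: "\<And>x. countable {t::real. x + t *\<^sub>R b \<in> E}"
  shows "emeasure lborel E = 0"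
proof -
  have meas: "(\<lambda>p. indicator E (snd p + fst p *\<^sub>R b) * indicator {0..1} (fst p) :: ennreal)
      \<in> borel_measurable (lborel \<Otimes>\<^sub>M lborel)"
    using E by measurable
  have shift: "(\<integral>\<^sup>+x. indicator E (x + t *\<^sub>R b) \<partial>lborel) = emeasure lborel E" for t :: real
  proof -
    have "emeasure lborel E = (\<integral>\<^sup>+x. indicator E x \<partial>(distr lborel borel ((+) (t *\<^sub>R b))))"
      using E by (simp add: lborel_distr_plus)
    also have "\<dots> = (\<integral>\<^sup>+x. indicator E (t *\<^sub>R b + x) \<partial>lborel)"
      using E by (subst nn_integral_distr) auto
    finally show ?thesis by (simp add: add.commute)
  qed
  have "emeasure lborel E = (\<integral>\<^sup>+t. emeasure lborel E * indicator {0..1::real} t \<partial>lborel)"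
    by (subst nn_integral_cmult) auto
  also have "\<dots> = (\<integral>\<^sup>+t. \<integral>\<^sup>+x. indicator E (x + t *\<^sub>R b) * indicator {0..1} t \<partial>lborel \<partial>lborel)"
  proof (rule nn_integral_cong)
    fix t :: real
    have "(\<lambda>x. indicator E (x + t *\<^sub>R b) :: ennreal) \<in> borel_measurable lborel"
      using E by measurable
    then show "emeasure lborel E * indicator {0..1} t
        = (\<integral>\<^sup>+x. indicator E (x + t *\<^sub>R b) * indicator {0..1} t \<partial>lborel)"
      by (subst nn_integral_multc) (auto simp: shift)
  qed
  also have "\<dots> = (\<integral>\<^sup>+x. \<integral>\<^sup>+t. indicator E (x + t *\<^sub>R b) * indicator {0..1} t \<partial>lborel \<partial>lborel)"
    using lborel_pair.Fubini[of "\<lambda>p. indicator E (snd p + fst p *\<^sub>R b) * indicator {0..1} (fst p)"]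
      lborel_pair.Fubini' [of "\<lambda>t x. indicator E (x + t *\<^sub>R b) * indicator {0..1} t"] meas
    by (simp add: case_prod_beta)
  also have "\<dots> = (\<integral>\<^sup>+x. 0 \<partial>(lborel :: 'a measure))"
  proof (rule nn_integral_cong)
    fix x :: 'a
    have null: "{t. x + t *\<^sub>R b \<in> E} \<in> null_sets lborel"
      using countable_imp_null_set_lborel[OF lines] .
    have "AE t in lborel. indicator E (x + t *\<^sub>R b) * indicator {0..1} t = (0::ennreal)"
      using AE_not_in[OF null] by eventually_elim (auto simp: indicator_def)
    then show "(\<integral>\<^sup>+t. indicator E (x + t *\<^sub>R b) * indicator {0..1} t \<partial>lborel) = (0::ennreal)"
      by (subst nn_integral_cong_AE) auto
  qed
  finally show ?thesis by simp
qed

section \<open>Holomorphic maps, coordinate projections and polydiscs\<close>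

lemma cn_holomorphic_on_imp_continuous_on:
  "f cn_holomorphic_on S \<Longrightarrow> continuous_on S f"
  unfolding cn_holomorphic_on_def
  by (meson continuous_at_imp_continuous_on has_derivative_continuous)

lemma cn_holomorphic_on_subset: "f cn_holomorphic_on S \<Longrightarrow> T \<subseteq> S \<Longrightarrow> f cn_holomorphic_on T"
  unfolding cn_holomorphic_on_def by blast

lemma cn_holomorphic_on_compose:
  assumes f: "f cn_holomorphic_on S" and g: "g cn_holomorphic_on T" and fS: "f ` S \<subseteq> T"
  shows "(g \<circ> f) cn_holomorphic_on S"
  unfolding cn_holomorphic_on_def
proof
  fix z assume z: "z \<in> S"
  obtain D where D: "(f has_derivative D) (at z)" "\<And>a v. D (a *s v) = a *s D v"
    using f z unfolding cn_holomorphic_on_def by blast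
  obtain D' where D': "(g has_derivative D') (at (f z))" "\<And>a v. D' (a *s v) = a *s D' v"
    using g z fS unfolding cn_holomorphic_on_def by blast
  have "(g \<circ> f has_derivative D' \<circ> D) (at z)"
    using D(1) D'(1) by (rule diff_chain_at)
  then show "\<exists>D. (g \<circ> f has_derivative D) (at z) \<and> (\<forall>a v. D (a *s v) = a *s D v)"
    using D(2) D'(2) by (intro exI[of _ "D' \<circ> D"]) simp
qed

lemma cn_holomorphic_on_cong:
  assumes "f cn_holomorphic_on S" "open S" "\<And>z. z \<in> S \<Longrightarrow> g z = f z"
  shows "g cn_holomorphic_on S"
  unfolding cn_holomorphic_on_def
proof
  fix z assume z: "z \<in> S"
  obtain D where D: "(f has_derivative D) (at z)" "\<And>a v. D (a *s v) = a *s D v"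
    using assms(1) z unfolding cn_holomorphic_on_def by blast
  have "(g has_derivative D) (at z)"
    using has_derivative_transform_within_open[OF D(1) assms(2) z] assms(3) by force
  then show "\<exists>D. (g has_derivative D) (at z) \<and> (\<forall>a v. D (a *s v) = a *s D v)"
    using D(2) by blast
qed

lemma cn_holomorphic_on_diff:
  assumes "f cn_holomorphic_on S" "g cn_holomorphic_on S"
  shows "(\<lambda>z. f z - g z) cn_holomorphic_on S"
  unfolding cn_holomorphic_on_def
proof
  fix z assume z: "z \<in> S"
  obtain D where D: "(f has_derivative D) (at z)" "\<And>a v. D (a *s v) = a *s D v"
    using assms(1) z unfolding cn_holomorphic_on_def by blast
  obtain D' where D': "(g has_derivative D') (at z)" "\<And>a v. D' (a *s v) = a *s D' v"
    using assms(2) z unfolding cn_holomorphic_on_def by blast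
  show "\<exists>D. ((\<lambda>z. f z - g z) has_derivative D) (at z) \<and> (\<forall>a v. D (a *s v) = a *s D v)"
    using has_derivative_diff[OF D(1) D'(1)] D(2) D'(2)
    by (intro exI[of _ "\<lambda>v. D v - D' v"]) (simp add: vec_eq_iff algebra_simps)
qed

text \<open>For \<open>J\<close> the transverse indices this is the point where the plaque through
  \<open>z\<close> meets the transverse slice through \<open>w\<close>. So
  \<open>mix J z (snd c y)\<close> projects to the slice through \<open>y\<close>, and
  \<open>mix J z 0\<close> labels the plaque of \<open>z\<close>. The zero set argument uses other
  index sets.\<close>

definition mix :: "'n set \<Rightarrow> complex^'n \<Rightarrow> complex^'n \<Rightarrow> complex^'n" where
  "mix J z w = (\<chi> i. if i \<in> J then z $ i else w $ i)"

lemma mix_nth: "mix J z w $ i = (if i \<in> J then z $ i else w $ i)"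
  by (simp add: mix_def)

lemma mix_mix [simp]: "mix J (mix J z w) v = mix J z v" "mix J z (mix J w v) = mix J z v"
  by (simp_all add: vec_eq_iff mix_nth)

lemma mix_same [simp]: "mix J z z = z"
  by (simp add: vec_eq_iff mix_nth)

lemma mix_in_polydisc: "z \<in> polydisc a r \<Longrightarrow> w \<in> polydisc a r \<Longrightarrow> mix J z w \<in> polydisc a r"
  by (simp add: polydisc_def mix_nth)

lemma has_derivative_mix:
  fixes w :: "complex^'n::finite"
  shows "((\<lambda>z. mix J z w) has_derivative (\<lambda>v. mix J v 0)) (at z)"
proof -
  have "linear (\<lambda>v::complex^'n. mix J v 0)"
    by (rule linearI) (simp_all add: vec_eq_iff mix_nth)
  then have "((\<lambda>v::complex^'n. mix J v 0) has_derivative (\<lambda>v. mix J v 0)) (at z)"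
    using linear_conv_bounded_linear bounded_linear_imp_has_derivative by blast
  then have "((\<lambda>v. mix J v 0 + mix J 0 w) has_derivative (\<lambda>v. mix J v 0)) (at z)"
    by (auto intro: has_derivative_add_const)
  moreover have "(\<lambda>v. mix J v 0 + mix J 0 w) = (\<lambda>z. mix J z w)"
    by (auto simp: fun_eq_iff vec_eq_iff mix_nth)
  ultimately show ?thesis by simp
qed

lemma mix_cn_holomorphic_on: "(\<lambda>z::complex^'n::finite. mix J z w) cn_holomorphic_on S"
  unfolding cn_holomorphic_on_def
  by (intro ballI exI[of _ "\<lambda>v. mix J v 0"] conjI has_derivative_mix)
    (simp add: vec_eq_iff mix_nth)

lemma continuous_on_mix: "continuous_on S (\<lambda>z::complex^'n::finite. mix J z w)"
  using mix_cn_holomorphic_on cn_holomorphic_on_imp_continuous_on by blast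

lemma continuous_on_mix_right: "continuous_on S (\<lambda>w::complex^'n::finite. mix J z w)"
proof -
  have "(\<lambda>w::complex^'n. mix J z w) = (\<lambda>w. mix (- J) w z)"
    by (auto simp: fun_eq_iff vec_eq_iff mix_nth)
  then show ?thesis using continuous_on_mix by metis
qed

lemma open_polydisc: "open (polydisc a r :: (complex^'n::finite) set)"
proof -
  have "polydisc a r = (\<Inter>i. {z. dist (z $ i) (a $ i) < r i})"
    by (auto simp: polydisc_def)
  moreover have "open {z :: complex^'n. dist (z $ i) (a $ i) < r i}" for i
    by (intro open_Collect_less continuous_intros)
  ultimately show ?thesis by auto
qed

lemma convex_polydisc: "convex (polydisc a r :: (complex^'n::finite) set)"
proof -
  have "polydisc a r = (\<Inter>i. (\<lambda>z. z $ i) -` ball (a $ i) (r i))"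
    by (auto simp: polydisc_def dist_commute)
  moreover have "convex ((\<lambda>z :: complex^'n. z $ i) -` ball (a $ i) (r i))" for i
    by (intro convex_linear_vimage) (auto intro: linearI)
  ultimately show ?thesis by (simp add: convex_INT)
qed

lemma polydisc_in_open:
  fixes z :: "complex^'n::finite"
  assumes "open S" "z \<in> S"
  obtains e where "e > 0" "polydisc z (\<lambda>_. e) \<subseteq> S"
proof -
  obtain d where d: "d > 0" "ball z d \<subseteq> S"
    using assms openE by blast
  \<comment> \<open>The norm is at most the sum of the \<open>CARD('n)\<close> coordinate norms;
    dividing by one more than their number makes the estimate strict.\<close>
  define e where "e = d / (real CARD('n) + 1)"
  have e: "e > 0" using d by (simp add: e_def)
  have "polydisc z (\<lambda>_. e) \<subseteq> ball z d"
  proof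
    fix w assume w: "w \<in> polydisc z (\<lambda>_. e)"
    have "norm (w - z) \<le> (\<Sum>i\<in>UNIV. norm ((w - z) $ i))"
      by (simp add: norm_vec_def L2_set_le_sum)
    also have "\<dots> \<le> (\<Sum>i\<in>(UNIV::'n set). e)"
      using w by (intro sum_mono) (auto simp: polydisc_def dist_norm less_imp_le)
    also have "\<dots> < d"
      using d by (simp add: e_def field_simps)
    finally show "w \<in> ball z d" by (simp add: dist_norm norm_minus_commute)
  qed
  then show ?thesis using that e d by blast
qed

text \<open>Exhaustion by closed balls, empty while their radius is negative. It supplies the
  F-sigma domain that \<open>holomorphic_countable_zeros\<close> asks for.\<close>

lemma fsigma_ball: "fsigma (ball (a :: 'a::metric_space) r)"
proof -
  have "ball a r = (\<Union>n. cball a (r - inverse (real (Suc n))))"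
  proof (intro equalityI subsetI)
    fix x assume "x \<in> ball a r"
    then obtain n where "inverse (real (Suc n)) < r - dist a x"
      using reals_Archimedean[of "r - dist a x"] by auto
    then have "x \<in> cball a (r - inverse (real (Suc n)))" unfolding mem_cball by linarith
    then show "x \<in> (\<Union>n. cball a (r - inverse (real (Suc n))))" by blast
  next
    fix x assume "x \<in> (\<Union>n. cball a (r - inverse (real (Suc n))))"
    then obtain n where "dist a x \<le> r - inverse (real (Suc n))" by auto
    moreover have "inverse (real (Suc n)) > 0" by simp
    ultimately show "x \<in> ball a r" unfolding mem_ball by linarith
  qed
  then show ?thesis using fsigma.intros[of "\<lambda>n. cball a (r - inverse (real (Suc n)))"] by simp
qed

text \<open>On a coordinate axis a complex-linear derivative \<open>D\<close> is multiplication by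
  \<open>D (axis i 1)\<close>, whose component \<open>k\<close> is the derivative in one variable.
  This opens the way to the one-variable theory of zeros.\<close>

lemma cn_holomorphic_on_slice:
  fixes f :: "complex^'n::finite \<Rightarrow> complex^'m::finite"
  assumes f: "f cn_holomorphic_on polydisc a r" and w: "w \<in> polydisc a r"
  shows "(\<lambda>s. f (\<chi> j. if j = i then s else w $ j) $ k) holomorphic_on ball (a $ i) (r i)"
  unfolding holomorphic_on_def
proof
  fix s assume s: "s \<in> ball (a $ i) (r i)"
  let ?p = "\<lambda>s. \<chi> j. if j = i then s else w $ j"
  have "?p s \<in> polydisc a r"
    using w s by (auto simp: polydisc_def dist_commute)
  then obtain D where D: "(f has_derivative D) (at (?p s))" "\<And>a v. D (a *s v) = a *s D v"
    using f unfolding cn_holomorphic_on_def by blast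
  have p: "?p = (\<lambda>s. axis i s + (\<chi> j. if j = i then 0 else w $ j))"
    by (auto simp: fun_eq_iff vec_eq_iff axis_def)
  have "linear (\<lambda>s::complex. axis i s :: complex^'n)"
    by (rule linearI) (simp_all add: vec_eq_iff axis_def)
  then have "((\<lambda>s::complex. axis i s :: complex^'n) has_derivative (\<lambda>s. axis i s)) (at s)"
    using linear_conv_bounded_linear bounded_linear_imp_has_derivative by blast
  then have "(?p has_derivative (\<lambda>s. axis i s)) (at s)"
    unfolding p by (auto intro: has_derivative_add_const)
  from diff_chain_at[OF this] D(1) have "(f \<circ> ?p has_derivative D \<circ> (\<lambda>s. axis i s)) (at s)"
    by blast
  then have "((\<lambda>s. (f \<circ> ?p) s $ k) has_derivative (\<lambda>s. (D \<circ> (\<lambda>s. axis i s)) s $ k)) (at s)"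
    by (rule bounded_linear.has_derivative[OF bounded_linear_vec_nth])
  moreover have "(\<lambda>s. (D \<circ> (\<lambda>s. axis i s)) s $ k) = (*) (D (axis i 1) $ k)"
  proof
    fix v
    have "axis i v = (v *s axis i 1 :: complex^'n)"
      by (simp add: vec_eq_iff axis_def)
    then have "D (axis i v) = v *s D (axis i 1)" using D(2) by metis
    then show "(D \<circ> (\<lambda>s. axis i s)) v $ k = D (axis i 1) $ k * v" by simp
  qed
  ultimately have "((\<lambda>s. f (?p s) $ k) has_field_derivative (D (axis i 1) $ k)) (at s)"
    unfolding has_field_derivative_def by (simp add: o_def)
  then show "(\<lambda>s. f (?p s) $ k) field_differentiable (at s within ball (a $ i) (r i))"
    using field_differentiable_at_within field_differentiable_def by blast
qed

text \<open>The sets \<open>Z S\<close> of points through which the map vanishes on the whole slice in the directions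
  \<open>S\<close> interpolate between the zero set and the polydisc, and they grow by null sets only.\<close>

lemma cn_holomorphic_zero_set_negligible:
  fixes f :: "complex^'n::finite \<Rightarrow> complex^'m::finite"
  assumes f: "f cn_holomorphic_on polydisc a r"
    and nz: "z0 \<in> polydisc a r" "f z0 \<noteq> 0"
  shows "negligible {z \<in> polydisc a r. f z = 0}"
proof -
  let ?P = "polydisc a r"
  define Z where "Z S = {z \<in> ?P. \<forall>w\<in>?P. f (mix S w z) = 0}" for S
  have cont: "continuous_on ?P f"
    using f cn_holomorphic_on_imp_continuous_on by blast
  \<comment> \<open>Relatively closed in the open polydisc, as an intersection of closed conditions
    over \<open>w\<close>; the Fubini lemma needs a Borel set.\<close>
  have Z_borel: "Z S \<in> sets borel" for S
  proof (cases "?P = {}")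
    case False
    have "closedin (top_of_set ?P) {z \<in> ?P. f (mix S w z) = 0}" if "w \<in> ?P" for w
    proof -
      have "continuous_on ?P (\<lambda>z. f (mix S w z))"
        using that by (intro continuous_on_compose2[OF cont continuous_on_mix_right])
          (auto intro: mix_in_polydisc)
      from continuous_closedin_preimage_constant[OF this, of 0] show ?thesis .
    qed
    then have "closedin (top_of_set ?P) (\<Inter>w\<in>?P. {z \<in> ?P. f (mix S w z) = 0})"
      using False by (intro closedin_INT) auto
    moreover have "(\<Inter>w\<in>?P. {z \<in> ?P. f (mix S w z) = 0}) = Z S"
      using False by (auto simp: Z_def)
    ultimately obtain C where "closed C" "Z S = C \<inter> ?P"
      by (metis closedin_closed inf_commute)
    then show ?thesis using open_polydisc[of a r] by auto
  qed (simp add: Z_def)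
  have step: "emeasure lborel (Z S - Z (insert i S)) = 0" if "i \<notin> S" for S i
  proof (rule lborel_null_if_countable_on_lines[where b = "axis i 1"])
    show "Z S - Z (insert i S) \<in> sets borel" using Z_borel by auto
    fix x :: "complex^'n"
    let ?T = "{t. x + t *\<^sub>R axis i 1 \<in> Z S - Z (insert i S)}"
    show "countable ?T"
    proof (rule ccontr)
      assume unc: "uncountable ?T"
      then obtain t0 where "x + t0 *\<^sub>R axis i 1 \<in> Z S - Z (insert i S)"
        using uncountable_infinite[OF unc] not_finite_existsD by blast
      then obtain w where w: "w \<in> ?P" "f (mix (insert i S) w (x + t0 *\<^sub>R axis i 1)) \<noteq> 0"
        and t0P: "x + t0 *\<^sub>R axis i 1 \<in> ?P"
        by (auto simp: Z_def)
      \<comment> \<open>Replacing coordinate \<open>i\<close> of \<open>v\<close> by that of any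
        point \<open>x + t *\<^sub>R axis i 1\<close> with \<open>t\<close> in \<open>?T\<close>
        gives a point of the \<open>S\<close>-slice through that point, where \<open>f\<close>
        vanishes; at \<open>v\<close> itself it does not. So one nonconstant function of one
        variable has all these parameters among its zeros.\<close>
      define v where "v = mix (insert i S) w (x + t0 *\<^sub>R axis i 1)"
      have v: "v \<in> ?P" unfolding v_def using w(1) t0P by (rule mix_in_polydisc)
      obtain k where k: "f v $ k \<noteq> 0"
        using w(2) by (auto simp: v_def vec_eq_iff)
      let ?g = "\<lambda>s. f (\<chi> j. if j = i then s else v $ j) $ k"
      have hol: "?g holomorphic_on ball (a $ i) (r i)"
        by (rule cn_holomorphic_on_slice[OF f v])
      have zero: "x $ i + of_real t \<in> {s \<in> ball (a $ i) (r i). ?g s = 0}" if "t \<in> ?T" for t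
      proof -
        let ?y = "x + t *\<^sub>R axis i 1"
        have y: "?y \<in> ?P" "\<And>w. w \<in> ?P \<Longrightarrow> f (mix S w ?y) = 0"
          using that by (auto simp: Z_def)
        have yi: "?y $ i = x $ i + of_real t" by (simp add: axis_def of_real_def)
        then have "x $ i + of_real t \<in> ball (a $ i) (r i)"
          using y(1) unfolding polydisc_def mem_ball mem_Collect_eq by (metis dist_commute)
        moreover have "(\<chi> j. if j = i then x $ i + of_real t else v $ j) = mix S w ?y"
          using \<open>i \<notin> S\<close> by (auto simp: vec_eq_iff mix_nth v_def axis_def of_real_def)
        ultimately show ?thesis using y(2)[OF w(1)] by simp
      qed
      have "v $ i \<in> ball (a $ i) (r i)"
        using v by (auto simp: polydisc_def dist_commute)
      moreover have "?g (v $ i) = f v $ k"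
      proof -
        have "(\<chi> j. if j = i then v $ i else v $ j) = v" by (simp add: vec_eq_iff)
        then show ?thesis by simp
      qed
      moreover have t0: "t0 \<in> ?T"
        using \<open>x + t0 *\<^sub>R axis i 1 \<in> Z S - Z (insert i S)\<close> by simp
      ultimately have "\<not> ?g constant_on ball (a $ i) (r i)"
        using zero[OF t0] k unfolding constant_on_def by force
      then have "countable {s \<in> ball (a $ i) (r i). ?g s = 0}"
        by (intro holomorphic_countable_zeros[OF hol]) (auto simp: fsigma_ball)
      then have "countable ((\<lambda>t. x $ i + complex_of_real t) ` ?T)"
        by (rule countable_subset[rotated]) (use zero in blast)
      then have "countable ?T"
        by (rule countable_image_inj_on) (auto simp: inj_on_def)
      with unc show False by blast
    qed
  qed
  have "negligible (Z {} - Z S)" for S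
  proof (induction rule: finite_induct[OF finite[of S]])
    case (2 i S)
    have "negligible (Z S - Z (insert i S))"
      using step[OF 2(2)] Z_borel
      by (auto intro!: null_sets_completionI simp: negligible_iff_null_sets null_sets_def)
    with 2(3) have "negligible ((Z {} - Z S) \<union> (Z S - Z (insert i S)))" by simp
    then show ?case by (rule negligible_subset) blast
  qed auto
  moreover have "Z UNIV = {}"
  proof -
    have "mix UNIV w z = w" for w z :: "complex^'n" by (simp add: vec_eq_iff mix_nth)
    then show ?thesis using nz by (auto simp: Z_def)
  qed
  moreover have "{z \<in> ?P. f z = 0} \<subseteq> Z {}"
    by (auto simp: Z_def mix_def)
  ultimately show ?thesis
    by (metis Diff_empty negligible_subset)
qed

section \<open>Foliated charts and the leaf topology\<close>

abbreviation inv_chart :: "('a, 'n::finite) chart \<Rightarrow> complex^'n \<Rightarrow> 'a" where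
  "inv_chart c \<equiv> inv_into (fst c) (snd c)"

abbreviation plaque :: "'n::finite set \<Rightarrow> ('a, 'n) chart \<Rightarrow> 'a \<Rightarrow> 'a set" where
  "plaque J c x \<equiv> {y. same_plaque J c x y}"

text \<open>Germs along \<open>D\<close> are treated as eventual statements, so that composing them
  is composing limits and domains never need to be named. The filter is not punctured: for
  \<open>x\<close> in \<open>D\<close> an eventual property holds at \<open>x\<close>
  itself.\<close>

definition nhds_on :: "'a topology \<Rightarrow> 'a set \<Rightarrow> 'a \<Rightarrow> 'a filter" where
  "nhds_on X D x = inf (nhdsin X x) (principal D)"

lemma eventually_nhds_on:
  "x \<in> topspace X \<Longrightarrow>
    eventually P (nhds_on X D x) \<longleftrightarrow> (\<exists>W. openin X W \<and> x \<in> W \<and> (\<forall>y\<in>W \<inter> D. P y))"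
  by (auto simp: nhds_on_def eventually_inf_principal eventually_nhdsin)

lemma nhds_on_le: "nhds_on X D x \<le> nhdsin X x"
  by (simp add: nhds_on_def)

lemma eventually_nhds_on_in: "\<forall>\<^sub>F q in nhds_on X D x. q \<in> D"
  by (simp add: nhds_on_def eventually_inf_principal)

lemma filterlim_nhds_on:
  "filterlim f (nhds_on X D x) G \<longleftrightarrow> filterlim f (nhdsin X x) G \<and> (\<forall>\<^sub>F q in G. f q \<in> D)"
  by (simp add: nhds_on_def filterlim_inf filterlim_principal)

lemma germ_eq_iff:
  assumes "x \<in> topspace X"
  shows "germ X D x g = germ X D x h \<longleftrightarrow> (\<forall>\<^sub>F q in nhds_on X D x. g q = h q)"
proof -
  have germ: "germ X D x h = {g. \<forall>\<^sub>F q in nhds_on X D x. g q = h q}" for h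
    using assms by (simp add: germ_def eventually_nhds_on)
  show ?thesis
  proof
    assume "germ X D x g = germ X D x h"
    moreover have "g \<in> germ X D x g" by (simp add: germ)
    ultimately show "\<forall>\<^sub>F q in nhds_on X D x. g q = h q" by (simp add: germ)
  next
    assume eq: "\<forall>\<^sub>F q in nhds_on X D x. g q = h q"
    have "(\<forall>\<^sub>F q in nhds_on X D x. k q = g q) \<longleftrightarrow> (\<forall>\<^sub>F q in nhds_on X D x. k q = h q)" for k
      using eq by (intro eventually_subst) (auto elim: eventually_mono)
    then show "germ X D x g = germ X D x h" by (simp add: germ)
  qed
qed

lemma same_plaque_sym: "same_plaque J c x y \<Longrightarrow> same_plaque J c y x"
  and same_plaque_trans: "same_plaque J c x y \<Longrightarrow> same_plaque J c y z \<Longrightarrow> same_plaque J c x z"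
  and same_plaque_refl: "x \<in> fst c \<Longrightarrow> same_plaque J c x x"
  by (auto simp: same_plaque_def agree_on_def)

section \<open>Topology of foliated charts\<close>

locale foliated_manifold =
  fixes X :: "'a topology" and A F :: "('a, 'n::finite) chart set" and J :: "'n set"
  assumes manifold: "complex_manifold X A" and foliation: "holomorphic_foliation X A J F"
begin

lemma
  assumes "c \<in> F"
  shows chart_open: "openin X (fst c)"
    and chart_image_open: "open (snd c ` fst c)"
    and chart_homeomorphic: "homeomorphic_map (subtopology X (fst c)) (top_of_set (snd c ` fst c)) (snd c)"
    and chart_polydisc: "\<exists>a r. snd c ` fst c = polydisc a r"
proof -
  have c: "coordinate_chart X A c \<and> (\<exists>a r. (\<forall>i. r i > 0) \<and> snd c ` fst c = polydisc a r)"
    using foliation assms by (simp add: holomorphic_foliation_def)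
  then show "openin X (fst c)" "open (snd c ` fst c)"
    "homeomorphic_map (subtopology X (fst c)) (top_of_set (snd c ` fst c)) (snd c)"
    by (simp_all add: coordinate_chart_def is_chart_def case_prod_beta)
  show "\<exists>a r. snd c ` fst c = polydisc a r" using c by blast
qed

lemma chart_subset: "c \<in> F \<Longrightarrow> fst c \<subseteq> topspace X"
  using chart_open openin_subset by blast

lemma chart_exists:
  assumes "x \<in> topspace X"
  obtains c where "c \<in> F" "x \<in> fst c"
  using foliation assms unfolding holomorphic_foliation_def by blast

lemma chart_inj: "c \<in> F \<Longrightarrow> inj_on (snd c) (fst c)"
  using chart_homeomorphic[of c] chart_subset[of c]
  by (auto simp: homeomorphic_map_def Int_absorb1)

lemma inv_chart [simp]: "c \<in> F \<Longrightarrow> x \<in> fst c \<Longrightarrow> inv_chart c (snd c x) = x"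
  using chart_inj by simp

lemma chart_continuous: "c \<in> F \<Longrightarrow> continuous_map (subtopology X (fst c)) euclidean (snd c)"
  using homeomorphic_imp_continuous_map[OF chart_homeomorphic]
  by (simp add: continuous_map_in_subtopology)

lemma inv_chart_continuous:
  assumes c: "c \<in> F"
  shows "continuous_map (top_of_set (snd c ` fst c)) (subtopology X (fst c)) (inv_chart c)"
proof -
  obtain g where g: "homeomorphic_maps (subtopology X (fst c)) (top_of_set (snd c ` fst c)) (snd c) g"
    using chart_homeomorphic[OF c] homeomorphic_map_maps by blast
  have "continuous_map (top_of_set (snd c ` fst c)) (subtopology X (fst c)) g"
    using g by (simp add: homeomorphic_maps_def)
  moreover have "inv_chart c z = g z" if "z \<in> snd c ` fst c" for z
    using g that c chart_subset[OF c] by (auto simp: homeomorphic_maps_def)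
  ultimately show ?thesis
    by (auto intro: continuous_map_eq)
qed

lemma chart_vimage_open:
  assumes "c \<in> F" "open S"
  shows "openin X {y \<in> fst c. snd c y \<in> S}"
proof -
  have "openin (subtopology X (fst c)) {y \<in> topspace (subtopology X (fst c)). snd c y \<in> S}"
    using openin_continuous_map_preimage[OF chart_continuous[OF assms(1)], of S] assms(2) by simp
  then have "openin X {y \<in> topspace (subtopology X (fst c)). snd c y \<in> S}"
    using chart_open[OF assms(1)] openin_trans_full by blast
  moreover have "{y \<in> topspace (subtopology X (fst c)). snd c y \<in> S} = {y \<in> fst c. snd c y \<in> S}"
    using chart_subset[OF assms(1)] by auto
  ultimately show ?thesis by simp
qed

lemma chart_image_openin:
  assumes c: "c \<in> F" and W: "openin X W"
  shows "open (snd c ` (fst c \<inter> W))"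
proof -
  have "openin (subtopology X (fst c)) (fst c \<inter> W)"
    using W by (metis inf_commute openin_subtopology_Int)
  then have "openin (top_of_set (snd c ` fst c)) (snd c ` (fst c \<inter> W))"
    using chart_homeomorphic[OF c] by (simp add: homeomorphic_map_openness_eq)
  then show ?thesis
    using chart_image_open[OF c] openin_open_trans by blast
qed

lemma chart_compact:
  assumes c: "c \<in> F" and K: "compact K" "K \<subseteq> snd c ` fst c"
  shows "compactin X {y \<in> fst c. snd c y \<in> K}"
proof -
  have "compactin (top_of_set (snd c ` fst c)) K"
    using K by (simp add: compactin_subtopology)
  then have "compactin (subtopology X (fst c)) (inv_chart c ` K)"
    using inv_chart_continuous[OF c] by (rule image_compactin)
  moreover have "inv_chart c ` K = {y \<in> fst c. snd c y \<in> K}"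
  proof (intro equalityI subsetI)
    fix x assume "x \<in> inv_chart c ` K"
    then show "x \<in> {y \<in> fst c. snd c y \<in> K}"
      using K(2) by (auto simp: f_inv_into_f inv_into_into subset_iff)
  next
    fix x assume "x \<in> {y \<in> fst c. snd c y \<in> K}"
    then show "x \<in> inv_chart c ` K" using inv_chart[OF c] by (force simp: image_iff)
  qed
  ultimately show ?thesis by (simp add: compactin_subtopology)
qed

lemma filterlim_inv_chart:
  assumes c: "c \<in> F" and x: "x \<in> fst c"
  shows "filterlim (inv_chart c) (nhdsin X x) (nhds (snd c x))"
  unfolding filterlim_iff
proof (intro allI impI)
  fix P assume "\<forall>\<^sub>F y in nhdsin X x. P y"
  then obtain W where W: "openin X W" "x \<in> W" "\<forall>y\<in>W. P y"
    using x chart_subset[OF c] by (auto simp: eventually_nhdsin)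
  then show "\<forall>\<^sub>F z in nhds (snd c x). P (inv_chart c z)"
    using chart_image_openin[OF c W(1)] x c
    by (auto simp: eventually_nhds intro!: exI[of _ "snd c ` (fst c \<inter> W)"])
qed

lemma eventually_in_open: "openin X W \<Longrightarrow> x \<in> W \<Longrightarrow> \<forall>\<^sub>F q in nhdsin X x. q \<in> W"
  by (auto simp: eventually_nhdsin)

lemma eventually_on_open: "openin X W \<Longrightarrow> x \<in> W \<Longrightarrow> \<forall>\<^sub>F q in nhds_on X D x. q \<in> W"
  by (rule filter_leD[OF nhds_on_le eventually_in_open])

lemma mix_in_chart: "c \<in> F \<Longrightarrow> x \<in> fst c \<Longrightarrow> y \<in> fst c \<Longrightarrow> mix J (snd c x) (snd c y) \<in> snd c ` fst c"
  using chart_polydisc[of c] mix_in_polydisc by (metis image_eqI)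

section \<open>Projection along plaques to a transverse disc\<close>

text \<open>The plaque through \<open>q\<close> meets the disc through \<open>y\<close> in exactly
  this point; it exists because the chart image is a polydisc, hence a product. The moving point is
  the last argument, so \<open>proj c y\<close> is the map whose germs give holonomy.\<close>

definition proj :: "('a, 'n) chart \<Rightarrow> 'a \<Rightarrow> 'a \<Rightarrow> 'a" where
  "proj c y q = inv_chart c (mix J (snd c q) (snd c y))"

lemma
  assumes "c \<in> F" "q \<in> fst c" "y \<in> fst c"
  shows proj_in: "proj c y q \<in> fst c"
    and chart_proj: "snd c (proj c y q) = mix J (snd c q) (snd c y)"
  using mix_in_chart[OF assms] by (auto simp: proj_def inv_into_into f_inv_into_f)

lemma
  assumes "c \<in> F" "q \<in> fst c" "y \<in> fst c"
  shows same_plaque_proj: "same_plaque J c q (proj c y q)"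
    and proj_in_disc: "proj c y q \<in> transverse_disc J c y"
  using proj_in[OF assms] chart_proj[OF assms] assms
  by (simp_all add: same_plaque_def transverse_disc_def) (simp_all add: agree_on_def mix_nth)

lemma proj_cong: "same_plaque J c q q' \<Longrightarrow> proj c y q = proj c y q'"
  unfolding proj_def by (rule arg_cong[of _ _ "inv_chart c"])
    (auto simp: vec_eq_iff mix_nth same_plaque_def agree_on_def)

lemma mix_chart_disc: "q \<in> transverse_disc J c y \<Longrightarrow> mix J (snd c q) (snd c y) = snd c q"
  by (auto simp: transverse_disc_def vec_eq_iff mix_nth agree_on_def)

lemma proj_disc: "c \<in> F \<Longrightarrow> q \<in> transverse_disc J c y \<Longrightarrow> proj c y q = q"
  unfolding proj_def by (subst mix_chart_disc) (auto simp: transverse_disc_def)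

lemma center_in_disc: "y \<in> fst c \<Longrightarrow> y \<in> transverse_disc J c y"
  by (simp add: transverse_disc_def agree_on_def)

lemma proj_same_plaque: "c \<in> F \<Longrightarrow> same_plaque J c x y \<Longrightarrow> proj c y x = y"
  by (metis center_in_disc proj_cong proj_disc same_plaque_def)

lemma continuous_proj:
  assumes c: "c \<in> F" and y: "y \<in> fst c"
  shows "continuous_map (subtopology X (fst c)) (subtopology X (fst c)) (proj c y)"
proof -
  have "continuous_map (subtopology X (fst c)) euclidean ((\<lambda>z. mix J z (snd c y)) \<circ> snd c)"
    using chart_continuous[OF c] by (rule continuous_map_compose) (simp add: continuous_on_mix)
  then have "continuous_map (subtopology X (fst c)) (top_of_set (snd c ` fst c))
      ((\<lambda>z. mix J z (snd c y)) \<circ> snd c)"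
    using mix_in_chart[OF c _ y] by (auto simp: continuous_map_in_subtopology)
  from continuous_map_compose[OF this inv_chart_continuous[OF c]]
  show ?thesis by (simp add: proj_def[abs_def] o_def)
qed

lemma openin_proj_vimage:
  assumes c: "c \<in> F" and y: "y \<in> fst c" and W: "openin X W"
  shows "openin X {q \<in> fst c. proj c y q \<in> W}"
proof -
  have "openin (subtopology X (fst c)) {q \<in> topspace (subtopology X (fst c)). proj c y q \<in> W \<inter> fst c}"
    using openin_continuous_map_preimage[OF continuous_proj[OF c y] openin_subtopology_Int[OF W]] .
  then have "openin X {q \<in> topspace (subtopology X (fst c)). proj c y q \<in> W \<inter> fst c}"
    using chart_open[OF c] openin_trans_full by blast
  moreover have "{q \<in> topspace (subtopology X (fst c)). proj c y q \<in> W \<inter> fst c}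
      = {q \<in> fst c. proj c y q \<in> W}"
    using chart_subset[OF c] proj_in[OF c _ y] by auto
  ultimately show ?thesis by simp
qed

lemma filterlim_proj:
  assumes c: "c \<in> F" and xy: "same_plaque J c x y"
  shows "filterlim (proj c y) (nhds_on X (transverse_disc J c y) y) (nhdsin X x)"
proof -
  have x: "x \<in> fst c" and y: "y \<in> fst c" using xy by (auto simp: same_plaque_def)
  have "\<forall>\<^sub>F q in nhdsin X x. proj c y q \<in> transverse_disc J c y"
    using eventually_in_open[OF chart_open[OF c] x] by eventually_elim (rule proj_in_disc[OF c _ y])
  moreover have "filterlim (proj c y) (nhdsin X y) (nhdsin X x)"
    unfolding filterlim_iff
  proof (intro allI impI)
    fix P assume "\<forall>\<^sub>F q in nhdsin X y. P q"
    then obtain W where W: "openin X W" "y \<in> W" "\<forall>q\<in>W. P q"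
      using y chart_subset[OF c] by (auto simp: eventually_nhdsin)
    have "\<forall>\<^sub>F q in nhdsin X x. q \<in> {q \<in> fst c. proj c y q \<in> W}"
      using x W(2) proj_same_plaque[OF c xy] by (intro eventually_in_open openin_proj_vimage c y W(1)) auto
    then show "\<forall>\<^sub>F q in nhdsin X x. P (proj c y q)"
      by eventually_elim (use W(3) in blast)
  qed
  ultimately show ?thesis by (simp add: filterlim_nhds_on)
qed

lemma transition_chart: "c \<in> F \<Longrightarrow> x \<in> fst c \<Longrightarrow> transition c e (snd c x) = snd e x"
  by (simp add: transition_def)

text \<open>Preservation of plaques is assumed only locally and in one direction for each ordered
  pair of charts. Using it for \<open>(c, e)\<close> and \<open>(e, c)\<close> and intersecting the
  neighbourhoods makes the two plaque relations coincide near \<open>y\<close>.\<close>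

lemma local_plaques:
  assumes c: "c \<in> F" and e: "e \<in> F" and y: "y \<in> fst c" "y \<in> fst e"
  obtains N where "openin X N" "y \<in> N" "N \<subseteq> fst c" "N \<subseteq> fst e"
    "\<forall>a\<in>N. \<forall>b\<in>N. same_plaque J c a b \<longleftrightarrow> same_plaque J e a b"
proof -
  have half: "\<exists>N. openin X N \<and> y \<in> N \<and> N \<subseteq> fst c \<and> N \<subseteq> fst e \<and>
      (\<forall>a\<in>N. \<forall>b\<in>N. same_plaque J c a b \<longrightarrow> same_plaque J e a b)"
    if c: "c \<in> F" and e: "e \<in> F" and y: "y \<in> fst c" "y \<in> fst e" for c e
  proof -
    have "preserves_plaques J c e"
      using foliation c e unfolding holomorphic_foliation_def by blast
    moreover have "snd c y \<in> overlap c e" using y by (auto simp: overlap_def)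
    ultimately have "\<exists>W. open W \<and> snd c y \<in> W \<and> W \<subseteq> overlap c e \<and> (\<forall>z1\<in>W. \<forall>z2\<in>W.
        agree_on J z1 z2 \<longrightarrow> agree_on J (transition c e z1) (transition c e z2))"
      unfolding preserves_plaques_def by (rule bspec)
    then obtain W where W: "open W" "snd c y \<in> W" "W \<subseteq> overlap c e"
      "\<forall>z1\<in>W. \<forall>z2\<in>W. agree_on J z1 z2 \<longrightarrow> agree_on J (transition c e z1) (transition c e z2)"
      by (elim exE conjE)
    let ?N = "{a \<in> fst c. snd c a \<in> W}"
    have "?N \<subseteq> fst e"
    proof
      fix a assume a: "a \<in> ?N"
      then obtain b where "b \<in> fst c" "b \<in> fst e" "snd c a = snd c b"
        using W(3) by (auto simp: overlap_def)
      then show "a \<in> fst e" using chart_inj[OF c] a by (auto dest: inj_onD)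
    qed
    moreover have "same_plaque J e a b" if "a \<in> ?N" "b \<in> ?N" "same_plaque J c a b" for a b
    proof -
      have "agree_on J (transition c e (snd c a)) (transition c e (snd c b))"
        using W(4) that by (simp add: same_plaque_def)
      then show ?thesis
        using that \<open>?N \<subseteq> fst e\<close> transition_chart[OF c] by (auto simp: same_plaque_def)
    qed
    ultimately show ?thesis
      using chart_vimage_open[OF c W(1)] y(1) W(2) by (intro exI[of _ ?N]) auto
  qed
  obtain N N' where "openin X N" "y \<in> N" "N \<subseteq> fst c" "N \<subseteq> fst e"
      "\<forall>a\<in>N. \<forall>b\<in>N. same_plaque J c a b \<longrightarrow> same_plaque J e a b"
    and "openin X N'" "y \<in> N'"
      "\<forall>a\<in>N'. \<forall>b\<in>N'. same_plaque J e a b \<longrightarrow> same_plaque J c a b"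
    using half[OF c e y] half[OF e c y(2,1)] by blast
  then show ?thesis by (intro that[of "N \<inter> N'"]) auto
qed

section \<open>The leaf topology\<close>

abbreviation Lt :: "'a topology" where "Lt \<equiv> leaf_topology X J F"

lemma openin_Lt_plaque: "c \<in> F \<Longrightarrow> openin X W \<Longrightarrow> openin Lt (W \<inter> plaque J c x)"
  unfolding leaf_topology_def by (intro topology_generated_by_Basis) blast

lemma openin_Lt:
  assumes "openin X W"
  shows "openin Lt W"
proof (subst openin_subopen, intro ballI)
  fix x assume x: "x \<in> W"
  then obtain c where c: "c \<in> F" "x \<in> fst c"
    using assms openin_subset chart_exists by blast
  then show "\<exists>T. openin Lt T \<and> x \<in> T \<and> T \<subseteq> W"
    using x openin_Lt_plaque[OF c(1) assms, of x]
    by (intro exI[of _ "W \<inter> plaque J c x"]) (auto simp: same_plaque_refl)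
qed

lemma topspace_Lt [simp]: "topspace Lt = topspace X"
proof
  show "topspace Lt \<subseteq> topspace X"
    unfolding leaf_topology_def using openin_subset by auto
  show "topspace X \<subseteq> topspace Lt"
    using openin_Lt[OF openin_topspace] openin_subset by blast
qed

text \<open>Any one chart around \<open>y\<close> suffices to test leaf neighbourhoods of
  \<open>y\<close>. The induction over the generated topology has a single substantial case, a basic
  set from another chart \<open>e\<close>, and there \<open>local_plaques\<close> translates plaques
  of \<open>e\<close> into plaques of \<open>c\<close>.\<close>

lemma openin_Lt_local:
  assumes S: "openin Lt S" and y: "y \<in> S" and c: "c \<in> F" "y \<in> fst c"
  obtains W where "openin X W" "y \<in> W" "W \<inter> plaque J c y \<subseteq> S"
proof -
  have "generate_topology_on {W \<inter> plaque J c x | W c x. openin X W \<and> c \<in> F} S"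
    using S by (simp add: leaf_topology_def openin_topology_generated_by_iff)
  then have "y \<in> S \<longrightarrow> (\<exists>W. openin X W \<and> y \<in> W \<and> W \<inter> plaque J c y \<subseteq> S)"
  proof induction
    case (Int a b)
    show ?case
    proof
      assume "y \<in> a \<inter> b"
      then obtain W W' where "openin X W" "y \<in> W" "W \<inter> plaque J c y \<subseteq> a"
        "openin X W'" "y \<in> W'" "W' \<inter> plaque J c y \<subseteq> b"
        using Int by auto
      then show "\<exists>W. openin X W \<and> y \<in> W \<and> W \<inter> plaque J c y \<subseteq> a \<inter> b"
        by (intro exI[of _ "W \<inter> W'"]) auto
    qed
  next
    case (UN K)
    show ?case
    proof
      assume "y \<in> \<Union>K"
      then obtain k where "k \<in> K" "y \<in> k" by blast
      have "\<exists>W. openin X W \<and> y \<in> W \<and> W \<inter> plaque J c y \<subseteq> k"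
        using UN.IH[OF \<open>k \<in> K\<close>] \<open>y \<in> k\<close> by (rule mp)
      then obtain W where "openin X W" "y \<in> W" "W \<inter> plaque J c y \<subseteq> k"
        by (elim exE conjE)
      then show "\<exists>W. openin X W \<and> y \<in> W \<and> W \<inter> plaque J c y \<subseteq> \<Union>K"
        using \<open>k \<in> K\<close> by (intro exI[of _ W]) auto
    qed
  next
    case (Basis s)
    then obtain W e x where s: "s = W \<inter> plaque J e x" "openin X W" "e \<in> F" by blast
    show ?case
    proof
      assume "y \<in> s"
      then have y: "y \<in> W" "same_plaque J e x y" using s by auto
      then have ye: "y \<in> fst e" by (simp add: same_plaque_def)
      obtain N where N: "openin X N" "y \<in> N" "N \<subseteq> fst c" "N \<subseteq> fst e"
        "\<forall>a\<in>N. \<forall>b\<in>N. same_plaque J c a b \<longleftrightarrow> same_plaque J e a b"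
        by (rule local_plaques[OF c(1) s(3) c(2) ye])
      have "W \<inter> N \<inter> plaque J c y \<subseteq> s"
      proof
        fix z assume z: "z \<in> W \<inter> N \<inter> plaque J c y"
        then have "same_plaque J e y z" using N(2,5) by auto
        then show "z \<in> s" using s(1) z same_plaque_trans[OF y(2)] by auto
      qed
      then show "\<exists>W. openin X W \<and> y \<in> W \<and> W \<inter> plaque J c y \<subseteq> s"
        using s(2) N(1,2) y(1) by (intro exI[of _ "W \<inter> N"]) auto
    qed
  qed auto
  then show ?thesis using y that by blast
qed

text \<open>Within a plaque, paths and compact sets can thus be built in chart coordinates and then
  read in the leaf topology.\<close>

lemma subtopology_plaque:
  assumes c: "c \<in> F"
  shows "subtopology Lt (plaque J c x) = subtopology X (plaque J c x)"
  unfolding topology_eq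
proof (intro allI iffI)
  fix S assume "openin (subtopology Lt (plaque J c x)) S"
  then obtain T where T: "openin Lt T" "S = T \<inter> plaque J c x" by (auto simp: openin_subtopology)
  show "openin (subtopology X (plaque J c x)) S"
  proof (subst openin_subopen, intro ballI)
    fix y assume y: "y \<in> S"
    then have "same_plaque J c x y" "y \<in> T" using T by auto
    then obtain W where W: "openin X W" "y \<in> W" "W \<inter> plaque J c y \<subseteq> T"
      using openin_Lt_local[OF T(1) _ c] by (auto simp: same_plaque_def)
    have "W \<inter> plaque J c x \<subseteq> S"
      using W(3) T(2) same_plaque_trans[OF same_plaque_sym[OF \<open>same_plaque J c x y\<close>]] by auto
    then show "\<exists>V. openin (subtopology X (plaque J c x)) V \<and> y \<in> V \<and> V \<subseteq> S"
      using W(1,2) \<open>same_plaque J c x y\<close>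
      by (intro exI[of _ "W \<inter> plaque J c x"]) (auto simp: openin_subtopology)
  qed
next
  fix S assume "openin (subtopology X (plaque J c x)) S"
  then show "openin (subtopology Lt (plaque J c x)) S"
    using openin_Lt by (auto simp: openin_subtopology)
qed

lemma Hausdorff_Lt: "Hausdorff_space Lt"
proof -
  have "Hausdorff_space X" using manifold by (simp add: complex_manifold_def)
  then show ?thesis unfolding Hausdorff_space_def using openin_Lt by (metis topspace_Lt)
qed

text \<open>The straight segment in coordinates stays in the convex polydisc and keeps the
  coordinates in \<open>J\<close> constant.\<close>

lemma plaque_path:
  assumes c: "c \<in> F" and yz: "same_plaque J c y z"
  obtains \<delta> where "pathin Lt \<delta>" "\<delta> 0 = y" "\<delta> 1 = z" "\<delta> ` {0..1} \<subseteq> fst c"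
proof -
  have y: "y \<in> fst c" and z: "z \<in> fst c" using yz by (auto simp: same_plaque_def)
  let ?l = "\<lambda>t::real. (1 - t) *\<^sub>R snd c y + t *\<^sub>R snd c z"
  have conv: "convex (snd c ` fst c)"
    using chart_polydisc[OF c] convex_polydisc by metis
  have l: "?l t \<in> snd c ` fst c" if "t \<in> {0..1}" for t
    using convexD_alt[OF conv, of "snd c y" "snd c z" t] that y z by auto
  define \<delta> where "\<delta> = inv_chart c \<circ> ?l"
  have \<delta>: "\<delta> t \<in> fst c" "snd c (\<delta> t) = ?l t" if "t \<in> {0..1}" for t
    using l[OF that] by (auto simp: \<delta>_def inv_into_into f_inv_into_f)
  have "continuous_map (top_of_set {0..1}) (top_of_set (snd c ` fst c)) ?l"
    using l by (auto simp: continuous_map_in_subtopology intro!: continuous_intros)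
  from continuous_map_compose[OF this inv_chart_continuous[OF c]]
  have "continuous_map (top_of_set {0..1}) X \<delta>"
    by (simp add: \<delta>_def continuous_map_in_subtopology)
  moreover have "\<delta> t \<in> plaque J c y" if "t \<in> {0..1}" for t
  proof -
    have "agree_on J (snd c y) (?l t)"
      using yz by (auto simp: same_plaque_def agree_on_def scaleR_left_diff_distrib)
    then show ?thesis using \<delta>[OF that] y by (simp add: same_plaque_def)
  qed
  ultimately have "continuous_map (top_of_set {0..1}) (subtopology X (plaque J c y)) \<delta>"
    by (auto simp: continuous_map_in_subtopology)
  then have "pathin Lt \<delta>"
    unfolding pathin_def subtopology_plaque[OF c, symmetric] by (simp add: continuous_map_in_subtopology)
  moreover have "\<delta> 0 = y" "\<delta> 1 = z" using c y z by (simp_all add: \<delta>_def)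
  ultimately show ?thesis using \<delta>(1) that by blast
qed

lemma same_plaque_connected:
  assumes "c \<in> F" "same_plaque J c y z"
  shows "connected_component_of Lt y z"
proof -
  obtain \<delta> where "pathin Lt \<delta>" "\<delta> 0 = y" "\<delta> 1 = z"
    using plaque_path[OF assms] by metis
  then show ?thesis
    using connectedin_path_image[of Lt \<delta>] by (force simp: connected_component_of_def)
qed

lemma leaf_eq: "L \<in> leaves X J F \<Longrightarrow> y \<in> L \<Longrightarrow> L = connected_component_of_set Lt y"
  by (auto simp: leaves_def connected_components_of_def dest: connected_component_of_equiv[THEN iffD1])

lemma leaf_saturated:
  "L \<in> leaves X J F \<Longrightarrow> y \<in> L \<Longrightarrow> c \<in> F \<Longrightarrow> same_plaque J c y z \<Longrightarrow> z \<in> L"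
  using leaf_eq same_plaque_connected by blast

lemma leaf_subset: "L \<in> leaves X J F \<Longrightarrow> L \<subseteq> topspace X"
  unfolding leaves_def using connected_components_of_subset by force

end

section \<open>Holonomy\<close>

lemma pathin_join:
  assumes g1: "pathin T g1" and g2: "pathin T g2" and eq: "g1 1 = g2 0"
  shows "pathin T (\<lambda>t. if t \<le> 1/2 then g1 (2 * t) else g2 (2 * t - 1))"
proof -
  let ?I = "top_of_set {0..1::real}"
  have "continuous_map ?I T (\<lambda>t. if t \<le> 1/2 then (g1 \<circ> (\<lambda>t. 2 * t)) t else (g2 \<circ> (\<lambda>t. 2 * t - 1)) t)"
  proof (intro continuous_map_cases_le continuous_map_compose)
    show "continuous_map (subtopology ?I {t \<in> topspace ?I. t \<le> 1/2}) ?I (\<lambda>t. 2 * t)"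
      by (auto simp: continuous_map_in_subtopology subtopology_subtopology intro!: continuous_intros)
    show "continuous_map (subtopology ?I {t \<in> topspace ?I. 1/2 \<le> t}) ?I (\<lambda>t. 2 * t - 1)"
      by (auto simp: continuous_map_in_subtopology subtopology_subtopology intro!: continuous_intros)
    show "(g1 \<circ> (\<lambda>t. 2 * t)) t = (g2 \<circ> (\<lambda>t. 2 * t - 1)) t" if "t = 1/2" for t
    proof -
      have "2 * t = 1" using that by simp
      then show ?thesis using eq by simp
    qed
  qed (use assms in \<open>auto simp: pathin_def\<close>)
  then show ?thesis unfolding pathin_def o_def .
qed

context foliated_manifold
begin

section \<open>Germs of plaque holonomy\<close>

text \<open>The germ version of \<open>plaque_holonomy\<close>: continuity on a neighbourhood is
  weakened to a limit at the centre. Slides in one chart compose by composing filter limits.\<close>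

definition slide :: "('a, 'n) chart \<Rightarrow> 'a set \<Rightarrow> 'a \<Rightarrow> 'a set \<Rightarrow> 'a \<Rightarrow> ('a \<Rightarrow> 'a) \<Rightarrow> bool" where
  "slide c D x E y f \<longleftrightarrow> f x = y \<and> filterlim f (nhds_on X E y) (nhds_on X D x) \<and>
     (\<forall>\<^sub>F q in nhds_on X D x. same_plaque J c q (f q))"

lemma eventually_nhds_on_center:
  assumes "\<forall>\<^sub>F q in nhds_on X D x. P q" "x \<in> D" "x \<in> topspace X"
  shows "P x"
  using assms by (auto simp: eventually_nhds_on)

lemma slide_same_plaque: "slide c D x E y f \<Longrightarrow> x \<in> D \<Longrightarrow> x \<in> topspace X \<Longrightarrow> same_plaque J c x y"
  unfolding slide_def by (metis (no_types, lifting) eventually_nhds_on_center)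

lemma slide_compose:
  assumes f: "slide c D x E y f" and g: "slide c E y G z g"
  shows "slide c D x G z (g \<circ> f)"
proof -
  have lim: "filterlim f (nhds_on X E y) (nhds_on X D x)" using f by (simp add: slide_def)
  have "\<forall>\<^sub>F q in nhds_on X D x. same_plaque J c (f q) (g (f q))"
    using filterlim_iff[THEN iffD1, OF lim] g by (auto simp: slide_def)
  moreover have "\<forall>\<^sub>F q in nhds_on X D x. same_plaque J c q (f q)" using f by (simp add: slide_def)
  ultimately have "\<forall>\<^sub>F q in nhds_on X D x. same_plaque J c q ((g \<circ> f) q)"
    by eventually_elim (auto intro: same_plaque_trans)
  moreover have "filterlim (g \<circ> f) (nhds_on X G z) (nhds_on X D x)"
    unfolding o_def using g lim filterlim_compose by (auto simp: slide_def)
  ultimately show ?thesis using f g by (simp add: slide_def)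
qed

lemma plaque_holonomy_imp_slide:
  assumes x: "x \<in> D" "x \<in> topspace X" and f: "plaque_holonomy X J c D x E y f"
  shows "slide c D x E y f"
proof -
  obtain W where W: "openin X W" "x \<in> W"
    "continuous_map (subtopology X (W \<inter> D)) (subtopology X E) f"
    "\<forall>p \<in> W \<inter> D. same_plaque J c p (f p)" and fx: "f x = y"
    using f by (auto simp: plaque_holonomy_def)
  have sub: "topspace (subtopology X (W \<inter> D)) = W \<inter> D"
    using openin_subset[OF W(1)] by auto
  have "\<forall>p\<in>W \<inter> D. f p \<in> E"
    using continuous_map_funspace[OF W(3)] unfolding sub by auto
  then have "\<forall>\<^sub>F q in nhds_on X D x. f q \<in> E"
    using W(1,2) x(2) by (auto simp: eventually_nhds_on)
  moreover have "filterlim f (nhdsin X y) (nhds_on X D x)"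
    unfolding filterlim_iff
  proof (intro allI impI)
    fix P assume P: "\<forall>\<^sub>F q in nhdsin X y. P q"
    have "y \<in> topspace X"
      using continuous_map_funspace[OF W(3)] W(2) x fx unfolding sub by auto
    then obtain V where V: "openin X V" "y \<in> V" "\<forall>q\<in>V. P q"
      using P by (auto simp: eventually_nhdsin)
    have "continuous_map (subtopology X (W \<inter> D)) X f"
      using W(3) by (simp add: continuous_map_in_subtopology)
    from openin_continuous_map_preimage[OF this V(1)]
    obtain T where T: "openin X T" "{q \<in> W \<inter> D. f q \<in> V} = T \<inter> (W \<inter> D)"
      unfolding sub by (auto simp: openin_subtopology)
    then have "x \<in> T \<inter> W" "\<forall>q\<in>(T \<inter> W) \<inter> D. P (f q)"
      using W(2) x fx V by auto
    then show "\<forall>\<^sub>F q in nhds_on X D x. P (f q)"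
      using T(1) W(1) x(2) by (auto simp: eventually_nhds_on intro!: exI[of _ "T \<inter> W"])
  qed
  ultimately show ?thesis
    using W(1,2,4) x(2) fx by (auto simp: slide_def filterlim_nhds_on eventually_nhds_on)
qed

text \<open>Near \<open>x\<close>, both \<open>f q\<close> and \<open>proj c y q\<close> lie close
  to \<open>y\<close> on the plaque of \<open>q\<close> in \<open>c\<close>. Near \<open>y\<close>
  the plaques of \<open>c\<close> and \<open>e\<close> agree, so \<open>proj e y\<close> sends both
  to the same point, and it fixes \<open>f q\<close>. The outer projection is there because the
  target disc is a slice of \<open>e\<close>, not of \<open>c\<close>.\<close>

lemma slide_eq_proj:
  assumes c: "c \<in> F" and e: "e \<in> F" and x: "x \<in> D" "x \<in> topspace X" and y: "y \<in> fst e"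
    and f: "slide c D x (transverse_disc J e y) y f"
  shows "\<forall>\<^sub>F q in nhds_on X D x. f q = proj e y (proj c y q)"
proof -
  have xy: "same_plaque J c x y" using f x by (rule slide_same_plaque)
  then have yc: "y \<in> fst c" by (simp add: same_plaque_def)
  obtain N where N: "openin X N" "y \<in> N" "N \<subseteq> fst c" "N \<subseteq> fst e"
    "\<forall>a\<in>N. \<forall>b\<in>N. same_plaque J c a b \<longleftrightarrow> same_plaque J e a b"
    by (rule local_plaques[OF c e yc y])
  have lim: "filterlim f (nhdsin X y) (nhds_on X D x)"
    and disc: "\<forall>\<^sub>F q in nhds_on X D x. f q \<in> transverse_disc J e y"
    and plaq: "\<forall>\<^sub>F q in nhds_on X D x. same_plaque J c q (f q)"
    using f by (auto simp: slide_def filterlim_nhds_on)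
  have "\<forall>\<^sub>F q in nhds_on X D x. f q \<in> N"
    using eventually_compose_filterlim[OF eventually_in_open[OF N(1,2)] lim] .
  moreover have "filterlim (proj c y) (nhdsin X y) (nhds_on X D x)"
    by (rule filterlim_mono[OF filterlim_proj[OF c xy] nhds_on_le nhds_on_le])
  then have "\<forall>\<^sub>F q in nhds_on X D x. proj c y q \<in> N"
    by (rule eventually_compose_filterlim[OF eventually_in_open[OF N(1,2)]])
  ultimately show ?thesis
    using disc plaq
  proof eventually_elim
    case (elim q)
    have "same_plaque J c q (proj c y q)"
      using elim(4) c yc by (intro same_plaque_proj) (auto simp: same_plaque_def)
    then have "same_plaque J c (f q) (proj c y q)"
      using elim(4) same_plaque_sym same_plaque_trans by metis
    then have "same_plaque J e (f q) (proj c y q)" using N(5) elim by auto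
    then show ?case using proj_cong proj_disc[OF e elim(3)] by metis
  qed
qed

lemma slide_unique:
  assumes "c \<in> F" "e \<in> F" "x \<in> D" "x \<in> topspace X" "y \<in> fst e"
    and "slide c D x (transverse_disc J e y) y f" "slide c D x (transverse_disc J e y) y g"
  shows "\<forall>\<^sub>F q in nhds_on X D x. f q = g q"
  using slide_eq_proj[OF assms(1-5,6)] slide_eq_proj[OF assms(1-5,7)]
  by eventually_elim simp

lemma plaque_holonomy_proj:
  assumes c: "c \<in> F" and e: "e \<in> F" and xy: "same_plaque J c x y" and y: "y \<in> fst e"
  shows "plaque_holonomy X J c D x (transverse_disc J e y) y (proj e y \<circ> proj c y)"
proof -
  have yc: "y \<in> fst c" and xc: "x \<in> fst c" using xy by (auto simp: same_plaque_def)
  obtain N where N: "openin X N" "y \<in> N" "N \<subseteq> fst c" "N \<subseteq> fst e"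
    "\<forall>a\<in>N. \<forall>b\<in>N. same_plaque J c a b \<longleftrightarrow> same_plaque J e a b"
    by (rule local_plaques[OF c e yc y])
  \<comment> \<open>Both successive images must lie in \<open>N\<close>, the region where a plaque
    of \<open>e\<close> may be read as a plaque of \<open>c\<close>.\<close>
  define W where "W = {q \<in> fst c. proj c y q \<in> N \<inter> {a \<in> fst e. proj e y a \<in> N}}"
  have "openin X W"
    unfolding W_def by (intro openin_proj_vimage c yc openin_Int N(1) e y)
  moreover have pxy: "proj c y x = y" "proj e y y = y"
    using proj_same_plaque[OF c xy] proj_same_plaque[OF e same_plaque_refl[OF y]] by auto
  then have "x \<in> W" using xc y N(2) by (simp add: W_def)
  moreover have "continuous_map (subtopology X (W \<inter> D)) (subtopology X (transverse_disc J e y))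
      (proj e y \<circ> proj c y)"
  proof -
    have "continuous_map (subtopology X (W \<inter> D)) X (proj c y)"
      using continuous_proj[OF c yc]
      by (auto simp: continuous_map_in_subtopology W_def intro: continuous_map_from_subtopology_mono)
    then have "continuous_map (subtopology X (W \<inter> D)) (subtopology X (fst e)) (proj c y)"
      by (auto simp: continuous_map_in_subtopology W_def)
    from continuous_map_compose[OF this continuous_proj[OF e y]]
    have "continuous_map (subtopology X (W \<inter> D)) X (proj e y \<circ> proj c y)"
      by (simp add: continuous_map_in_subtopology)
    moreover have "(proj e y \<circ> proj c y) q \<in> transverse_disc J e y" if "q \<in> W" for q
      using that proj_in_disc[OF e _ y] by (auto simp: W_def)
    ultimately show ?thesis by (auto simp: continuous_map_in_subtopology)
  qed
  moreover have "same_plaque J c q ((proj e y \<circ> proj c y) q)" if q: "q \<in> W" for q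
  proof -
    have qW: "q \<in> fst c" "proj c y q \<in> N" "proj c y q \<in> fst e" "proj e y (proj c y q) \<in> N"
      using q by (auto simp: W_def)
    have "same_plaque J c q (proj c y q)" using c qW(1) yc by (rule same_plaque_proj)
    moreover have "same_plaque J e (proj c y q) (proj e y (proj c y q))"
      using e qW(3) y by (rule same_plaque_proj)
    then have "same_plaque J c (proj c y q) (proj e y (proj c y q))"
      using N(5) qW by auto
    ultimately show ?thesis unfolding o_def by (rule same_plaque_trans)
  qed
  ultimately show ?thesis
    unfolding plaque_holonomy_def by (intro conjI exI[of _ W]) (simp_all add: pxy)
qed

lemma transverse_disc_at_center: "transverse_disc_at J F x D \<Longrightarrow> x \<in> D"
  and transverse_disc_at_topspace: "transverse_disc_at J F x D \<Longrightarrow> x \<in> topspace X"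
  by (auto simp: transverse_disc_at_def center_in_disc dest: chart_subset)

text \<open>The partition and the fold are hidden: \<open>P\<close> sees only the current point, its
  disc and the map composed so far, and every step appends one slide.\<close>

lemma holonomy_along_induct [consumes 1, case_names base step]:
  assumes hol: "holonomy_along X J F \<gamma> D E h"
    and base: "transverse_disc_at J F (\<gamma> 0) D \<Longrightarrow> P (\<gamma> 0) D id"
    and step: "\<And>y T g c z T' f. P y T g \<Longrightarrow> transverse_disc_at J F y T \<Longrightarrow>
      transverse_disc_at J F z T' \<Longrightarrow> c \<in> F \<Longrightarrow> slide c T y T' z f \<Longrightarrow> P z T' (f \<circ> g)"
  shows "P (\<gamma> 1) E h"
proof -
  obtain k t c T f where
    t: "t 0 = 0" "t k = 1" and T: "T 0 = D" "T k = E"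
    and disc: "\<And>j. j \<le> k \<Longrightarrow> transverse_disc_at J F (\<gamma> (t j)) (T j)"
    and sl: "\<And>j. j < k \<Longrightarrow> c j \<in> F \<and>
        plaque_holonomy X J (c j) (T j) (\<gamma> (t j)) (T (Suc j)) (\<gamma> (t (Suc j))) (f j)"
    and h: "h = fold (\<lambda>j g. f j \<circ> g) [0..<k::nat] id"
    using hol unfolding holonomy_along_def by blast
  have "P (\<gamma> (t i)) (T i) (fold (\<lambda>j g. f j \<circ> g) [0..<i] id)" if "i \<le> k" for i
    using that
  proof (induction i)
    case 0
    then show ?case using base disc[of 0] t T by (simp add: id_def)
  next
    case (Suc i)
    have d: "transverse_disc_at J F (\<gamma> (t i)) (T i)" using disc Suc by simp
    have "slide (c i) (T i) (\<gamma> (t i)) (T (Suc i)) (\<gamma> (t (Suc i))) (f i)"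
      using sl[of i] Suc.prems transverse_disc_at_center[OF d] transverse_disc_at_topspace[OF d]
      by (intro plaque_holonomy_imp_slide) auto
    moreover have "P (\<gamma> (t i)) (T i) (fold (\<lambda>j g. f j \<circ> g) [0..<i] id)"
      by (rule Suc.IH) (use Suc.prems in simp)
    ultimately have "P (\<gamma> (t (Suc i))) (T (Suc i)) (f i \<circ> fold (\<lambda>j g. f j \<circ> g) [0..<i] id)"
      using disc[of "Suc i"] sl[of i] Suc.prems by (intro step[OF _ d, where c = "c i"]) simp_all
    moreover have "fold (\<lambda>j g. f j \<circ> g) [0..<Suc i] id = f i \<circ> fold (\<lambda>j g. f j \<circ> g) [0..<i] id"
      by simp
    ultimately show ?case by (simp only:)
  qed
  from this[of k] show ?thesis using t T h by simp
qed

text \<open>The last clause links holonomy with counting: near the base point, holonomy moves points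
  only within their own leaves.\<close>

lemma holonomy_along_germ:
  assumes "holonomy_along X J F \<gamma> D E h"
  shows "h (\<gamma> 0) = \<gamma> 1 \<and> filterlim h (nhds_on X E (\<gamma> 1)) (nhds_on X D (\<gamma> 0)) \<and>
    transverse_disc_at J F (\<gamma> 1) E \<and>
    (\<forall>\<^sub>F q in nhds_on X D (\<gamma> 0). connected_component_of Lt q (h q))"
  using assms
proof (induction rule: holonomy_along_induct)
  case base
  then have "\<gamma> 0 \<in> topspace X" by (rule transverse_disc_at_topspace)
  then have "\<forall>\<^sub>F q in nhds_on X D (\<gamma> 0). q \<in> topspace X"
    using eventually_on_open[OF openin_topspace] by blast
  then have "\<forall>\<^sub>F q in nhds_on X D (\<gamma> 0). connected_component_of Lt q (id q)"
    by eventually_elim (simp add: connected_component_of_refl)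
  then show ?case using base by (auto simp: filterlim_ident id_def)
next
  case (step y T g c z T' f)
  have lim: "filterlim g (nhds_on X T y) (nhds_on X D (\<gamma> 0))" using step by simp
  have "\<forall>\<^sub>F q in nhds_on X D (\<gamma> 0). same_plaque J c (g q) (f (g q))"
    using filterlim_iff[THEN iffD1, OF lim] step(5) by (auto simp: slide_def)
  moreover have "\<forall>\<^sub>F q in nhds_on X D (\<gamma> 0). connected_component_of Lt q (g q)"
    using step by simp
  ultimately have "\<forall>\<^sub>F q in nhds_on X D (\<gamma> 0). connected_component_of Lt q ((f \<circ> g) q)"
    by eventually_elim
      (use same_plaque_connected[OF step(4)] connected_component_of_trans in fastforce)
  moreover have "filterlim (f \<circ> g) (nhds_on X T' z) (nhds_on X D (\<gamma> 0))"
    unfolding o_def using step(5) lim filterlim_compose by (auto simp: slide_def)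
  ultimately show ?case using step by (simp add: slide_def o_def)
qed

end

section \<open>From positive measure to finite holonomy\<close>

definition holo_near :: "(complex^'n::finite \<Rightarrow> complex^'m::finite) \<Rightarrow> complex^'n \<Rightarrow> bool" where
  "holo_near f z \<longleftrightarrow> (\<exists>S. open S \<and> z \<in> S \<and> f cn_holomorphic_on S)"

lemma holo_near_compose:
  assumes f: "holo_near f z" and g: "holo_near g (f z)"
  shows "holo_near (g \<circ> f) z"
proof -
  obtain S where S: "open S" "z \<in> S" "f cn_holomorphic_on S"
    using f by (auto simp: holo_near_def)
  obtain T where T: "open T" "f z \<in> T" "g cn_holomorphic_on T"
    using g by (auto simp: holo_near_def)
  have "open (S \<inter> f -` T)"
    using S(1,3) T(1) cn_holomorphic_on_imp_continuous_on continuous_open_preimage by blast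
  moreover have "(g \<circ> f) cn_holomorphic_on (S \<inter> f -` T)"
    by (rule cn_holomorphic_on_compose[OF cn_holomorphic_on_subset[OF S(3)] T(3)]) auto
  ultimately show ?thesis using S T by (auto simp: holo_near_def)
qed

lemma holo_near_cong:
  assumes f: "holo_near f z" and eq: "\<forall>\<^sub>F w in nhds z. g w = f w"
  shows "holo_near g z"
proof -
  obtain S where S: "open S" "z \<in> S" "f cn_holomorphic_on S"
    using f by (auto simp: holo_near_def)
  obtain T where T: "open T" "z \<in> T" "\<forall>w\<in>T. g w = f w"
    using eq by (auto simp: eventually_nhds)
  have "g cn_holomorphic_on (S \<inter> T)"
    by (rule cn_holomorphic_on_cong[OF cn_holomorphic_on_subset[OF S(3)]])
      (use S T in \<open>auto simp: open_Int\<close>)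
  then show ?thesis using S T by (auto simp: holo_near_def open_Int intro!: exI[of _ "S \<inter> T"])
qed

lemma holo_near_mix: "holo_near (\<lambda>z. mix J z w) z"
  unfolding holo_near_def using mix_cn_holomorphic_on open_UNIV by blast

text \<open>If every point of \<open>S\<close> had a neighbourhood with negligible trace on
  \<open>S\<close>, countably many of these would cover \<open>S\<close>. No measurability of
  \<open>S\<close> enters.\<close>

lemma not_negligible_point:
  fixes S :: "'a::euclidean_space set"
  assumes "\<not> negligible S"
  obtains p where "p \<in> S" "\<And>N. open N \<Longrightarrow> p \<in> N \<Longrightarrow> \<not> negligible (S \<inter> N)"
proof -
  obtain p where p: "p \<in> S" "\<And>U. openin (top_of_set S) U \<Longrightarrow> p \<in> U \<Longrightarrow> \<not> negligible U"
    using assms locally_negligible_alt[of S] by auto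
  have "\<not> negligible (S \<inter> N)" if "open N" "p \<in> N" for N
    using p that by (intro p(2)) (auto simp: openin_open)
  then show ?thesis using p(1) that by blast
qed

context foliated_manifold
begin

text \<open>Foliated charts are assumed compatible with the atlas \<open>A\<close>, not with each
  other, so the change of charts is factored through a chart of \<open>A\<close> around
  \<open>y\<close>.\<close>

lemma holo_near_transition:
  assumes c: "c \<in> F" and e: "e \<in> F" and y: "y \<in> fst c" "y \<in> fst e"
  shows "holo_near (transition c e) (snd c y)"
proof -
  obtain a where a: "a \<in> A" "y \<in> fst a"
    using manifold chart_subset[OF c] y(1) unfolding complex_manifold_def by blast
  have cha: "is_chart X a" using manifold a(1) by (simp add: complex_manifold_def)
  then have aX: "openin X (fst a)" "inj_on (snd a) (fst a)"
    by (auto simp: is_chart_def case_prod_beta homeomorphic_map_def Int_absorb1 dest: openin_subset)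
  have "coordinate_chart X A c" "coordinate_chart X A e"
    using foliation c e by (simp_all add: holomorphic_foliation_def)
  then have hol: "transition c a cn_holomorphic_on overlap c a"
    "transition a e cn_holomorphic_on overlap a e"
    using a(1) by (auto simp: coordinate_chart_def holo_compatible_def)
  define S where "S = snd c ` (fst c \<inter> (fst a \<inter> fst e))"
  have S: "open S" unfolding S_def
    by (intro chart_image_openin c openin_Int aX(1) chart_open e)
  have tr: "transition c a (snd c q) = snd a q" "transition a e (snd a q) = snd e q"
    "transition c e (snd c q) = snd e q" if "q \<in> fst c \<inter> (fst a \<inter> fst e)" for q
    using that transition_chart[OF c] aX(2) by (auto simp: transition_def)
  have "(transition a e \<circ> transition c a) cn_holomorphic_on S"
  proof (rule cn_holomorphic_on_compose[OF cn_holomorphic_on_subset[OF hol(1)] hol(2)])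
    show "S \<subseteq> overlap c a" by (auto simp: S_def overlap_def)
    show "transition c a ` S \<subseteq> overlap a e" by (auto simp: S_def overlap_def tr)
  qed
  then have "transition c e cn_holomorphic_on S"
    by (rule cn_holomorphic_on_cong[OF _ S]) (auto simp: S_def tr)
  then show ?thesis using S y a(2) by (auto simp: holo_near_def S_def)
qed

text \<open>The disc is parametrised redundantly by an open set of full dimension, the leafwise
  coordinates being forgotten. Through this limit, eventual statements on the disc become statements
  near \<open>snd d x\<close>, where measure and holomorphy make sense.\<close>

lemma filterlim_disc:
  assumes d: "d \<in> F" and x: "x \<in> fst d"
  shows "filterlim (\<lambda>z. inv_chart d (mix J z (snd d x))) (nhds_on X (transverse_disc J d x) x)
    (nhds (snd d x))"
proof -
  have "filterlim (\<lambda>z. mix J z (snd d x)) (nhds (mix J (snd d x) (snd d x))) (nhds (snd d x))"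
  proof -
    have "isCont (\<lambda>z. mix J z (snd d x)) (snd d x)"
      using continuous_on_mix[of UNIV J "snd d x"] by (simp add: continuous_on_eq_continuous_at)
    then show ?thesis
      using tendsto_at_iff_tendsto_nhds[of "\<lambda>z. mix J z (snd d x)" "snd d x"]
      unfolding isCont_def by blast
  qed
  then have "filterlim (\<lambda>z. mix J z (snd d x)) (nhds (snd d x)) (nhds (snd d x))" by simp
  from filterlim_compose[OF filterlim_inv_chart[OF d x] this]
  have "filterlim (\<lambda>z. inv_chart d (mix J z (snd d x))) (nhdsin X x) (nhds (snd d x))" .
  moreover have "\<forall>\<^sub>F z in nhds (snd d x). z \<in> snd d ` fst d"
    using chart_image_open[OF d] x by (intro eventually_nhds_in_open) auto
  then have "\<forall>\<^sub>F z in nhds (snd d x). inv_chart d (mix J z (snd d x)) \<in> transverse_disc J d x"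
  proof eventually_elim
    case (elim z)
    then obtain q where q: "q \<in> fst d" "z = snd d q" by blast
    show ?case using proj_in_disc[OF d q(1) x] by (simp add: proj_def q(2))
  qed
  ultimately show ?thesis by (simp add: filterlim_nhds_on)
qed

text \<open>In coordinates each slide is a composition of chart changes and of maps
  \<open>mix J\<close>, all holomorphic, and composition preserves this.\<close>

lemma holonomy_along_holomorphic:
  assumes hol: "holonomy_along X J F \<gamma> (transverse_disc J d x) E h"
    and d: "d \<in> F" "x \<in> fst d" and \<gamma>: "\<gamma> 0 = x"
    and e: "e \<in> F" "\<gamma> 1 \<in> fst e" "E = transverse_disc J e (\<gamma> 1)"
  shows "holo_near (\<lambda>z. snd e (h (inv_chart d (mix J z (snd d x))))) (snd d x)"
proof -
  let ?D = "transverse_disc J d x" and ?disc = "\<lambda>z. inv_chart d (mix J z (snd d x))"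
  note disc = filterlim_disc[OF d]
  have disc0: "inv_chart d (snd d x) = x" using d by simp
  \<comment> \<open>The claim covers every chart of which the current disc is a slice, because the
    induction does not record the chart that the disc came from.\<close>
  have "h x = \<gamma> 1 \<and> filterlim h (nhds_on X E (\<gamma> 1)) (nhds_on X ?D x) \<and>
    (\<forall>e\<in>F. \<gamma> 1 \<in> fst e \<longrightarrow> E = transverse_disc J e (\<gamma> 1) \<longrightarrow>
      holo_near (\<lambda>z. snd e (h (?disc z))) (snd d x))"
    using hol
  proof (induction rule: holonomy_along_induct)
    case base
    have "holo_near (transition d e \<circ> (\<lambda>z. mix J z (snd d x))) (snd d x)" if "e \<in> F" "x \<in> fst e" for e
      using that d holo_near_transition by (intro holo_near_compose holo_near_mix) auto
    then show ?case using \<gamma> by (simp add: transition_def o_def id_def filterlim_ident)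
  next
    case (step y T g c z T' f)
    have gx: "g x = y" and g: "filterlim g (nhds_on X T y) (nhds_on X ?D x)"
      and IH: "\<And>e. e \<in> F \<Longrightarrow> y \<in> fst e \<Longrightarrow> T = transverse_disc J e y \<Longrightarrow>
        holo_near (\<lambda>z. snd e (g (?disc z))) (snd d x)"
      using step.IH by auto
    obtain e where e: "e \<in> F" "y \<in> fst e" "T = transverse_disc J e y"
      using step(2) by (auto simp: transverse_disc_at_def)
    have yT: "y \<in> T" "y \<in> topspace X"
      using step(2) transverse_disc_at_center transverse_disc_at_topspace by auto
    have yz: "same_plaque J c y z" using slide_same_plaque[OF step(5) yT] .
    then have yc: "y \<in> fst c" and zc: "z \<in> fst c" by (auto simp: same_plaque_def)
    have gd: "filterlim (\<lambda>z. g (?disc z)) (nhds_on X T y) (nhds (snd d x))"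
      using filterlim_compose[OF g disc] .
    have "holo_near (\<lambda>z. snd e' ((f \<circ> g) (?disc z))) (snd d x)"
      if e': "e' \<in> F" "z \<in> fst e'" "T' = transverse_disc J e' z" for e'
    proof -
      \<comment> \<open>From the inside: pass from \<open>e\<close> to the sliding chart
        \<open>c\<close>, project to the slice of \<open>c\<close> through \<open>z\<close>, pass to
        \<open>e'\<close>, project to the slice of \<open>e'\<close>. This is
        \<open>slide_eq_proj\<close> in coordinates.\<close>
      let ?G = "(\<lambda>w. mix J w (snd e' z)) \<circ> (transition c e' \<circ> ((\<lambda>w. mix J w (snd c z)) \<circ>
        (transition e c \<circ> (\<lambda>w. snd e (g (?disc w))))))"
      have tr: "transition e c (snd e y) = snd c y" using transition_chart e by blast
      have mx: "mix J (snd c y) (snd c z) = snd c z"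
        using yz by (auto simp: vec_eq_iff mix_nth same_plaque_def agree_on_def)
      have "holo_near ?G (snd d x)"
        using IH[OF e] holo_near_transition[OF e(1) step(4) e(2) yc]
          holo_near_transition[OF step(4) e'(1) zc e'(2)]
        by (intro holo_near_compose holo_near_mix) (simp_all add: disc0 gx tr mx)
      moreover have "\<forall>\<^sub>F w in nhds (snd d x). snd e' ((f \<circ> g) (?disc w)) = ?G w"
      proof -
        have "\<forall>\<^sub>F q in nhds_on X T y. f q = proj e' z (proj c z q)"
          using slide_eq_proj[OF step(4) e'(1) yT e'(2)] step(5) e'(3) by blast
        moreover have "\<forall>\<^sub>F q in nhds_on X T y. q \<in> fst e"
          using eventually_on_open[OF chart_open[OF e(1)] e(2)] .
        moreover have "\<forall>\<^sub>F q in nhds_on X T y. q \<in> {q \<in> fst c. proj c z q \<in> fst e'}"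
          using proj_same_plaque[OF step(4) yz] e'(2) yc
          by (intro eventually_on_open openin_proj_vimage step(4) zc chart_open e'(1)) auto
        ultimately have "\<forall>\<^sub>F q in nhds_on X T y. snd e' (f q) =
            mix J (transition c e' (mix J (transition e c (snd e q)) (snd c z))) (snd e' z)"
        proof eventually_elim
          case (elim q)
          have "snd e' (f q) = mix J (snd e' (proj c z q)) (snd e' z)"
            using elim chart_proj[OF e'(1) _ e'(2)] by simp
          moreover have "transition e c (snd e q) = snd c q"
            using transition_chart[OF e(1)] elim(2) by simp
          ultimately show ?case by (simp add: transition_def proj_def)
        qed
        from eventually_compose_filterlim[OF this gd] show ?thesis by simp
      qed
      ultimately show ?thesis by (rule holo_near_cong)
    qed
    moreover have "filterlim (f \<circ> g) (nhds_on X T' z) (nhds_on X ?D x)"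
      unfolding o_def using step(5) g filterlim_compose by (auto simp: slide_def)
    moreover have "(f \<circ> g) x = z" using step(5) gx by (simp add: slide_def)
    ultimately show ?case by blast
  qed
  then show ?thesis using e by blast
qed


section \<open>Counting the plaques of compact leaves\<close>

text \<open>The part of \<open>L\<close> over \<open>K\<close> is leaf-closed in \<open>L\<close>,
  hence leaf-compact, and plaques are leaf-open; a finite subcover carries finitely many labels.
  Restricting to \<open>K\<close> is essential, since \<open>L\<close> may accumulate plaques only
  at points outside the chart domain.\<close>

lemma compact_leaf_finite_plaques:
  assumes L: "compact_leaf X J F L" and c: "c \<in> F" and K: "compact K" "K \<subseteq> snd c ` fst c"
  shows "finite ((\<lambda>a. mix J (snd c a) 0) ` {a \<in> L \<inter> fst c. snd c a \<in> K})"
proof -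
  let ?B = "L \<inter> {a \<in> fst c. snd c a \<in> K}"
  have "kc_space X"
    using manifold Hausdorff_imp_kc_space by (auto simp: complex_manifold_def)
  then have "closedin X {a \<in> fst c. snd c a \<in> K}"
    using compactin_imp_closedin_gen chart_compact[OF c K] by blast
  then have "closedin Lt {a \<in> fst c. snd c a \<in> K}"
    using openin_Lt by (auto simp: closedin_def)
  then have comp: "compactin Lt ?B"
    using L compact_Int_closedin by (auto simp: compact_leaf_def)
  have "\<exists>\<F>. finite \<F> \<and> \<F> \<subseteq> (\<lambda>a. topspace X \<inter> plaque J c a) ` ?B \<and> ?B \<subseteq> \<Union>\<F>"
    using c comp
    by (intro compactinD[OF comp])
      (use chart_subset[OF c] in \<open>auto simp: same_plaque_refl intro!: openin_Lt_plaque\<close>)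
  then obtain \<F> where \<F>: "finite \<F>" "\<F> \<subseteq> (\<lambda>a. topspace X \<inter> plaque J c a) ` ?B" "?B \<subseteq> \<Union>\<F>"
    by blast
  then obtain B where B: "finite B" "?B \<subseteq> (\<Union>a\<in>B. topspace X \<inter> plaque J c a)"
    using finite_subset_image[OF \<F>(1,2)] by blast
  have "(\<lambda>a. mix J (snd c a) 0) ` {a \<in> L \<inter> fst c. snd c a \<in> K} \<subseteq> (\<lambda>a. mix J (snd c a) 0) ` B"
  proof
    fix v assume "v \<in> (\<lambda>a. mix J (snd c a) 0) ` {a \<in> L \<inter> fst c. snd c a \<in> K}"
    then obtain a where a: "a \<in> ?B" "v = mix J (snd c a) 0" by blast
    then obtain b where b: "b \<in> B" "same_plaque J c b a" using B(2) by blast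
    then have "v = mix J (snd c b) 0"
      using a(2) by (auto simp: vec_eq_iff mix_nth same_plaque_def agree_on_def)
    then show "v \<in> (\<lambda>a. mix J (snd c a) 0) ` B" using b(1) by blast
  qed
  then show ?thesis using B(1) finite_subset by blast
qed

text \<open>Each value labels a plaque of \<open>c\<close> that the leaf of \<open>q\<close> meets
  over \<open>V\<close>. Filling the leafwise coordinates with 0 merely yields one vector per
  plaque; it need not lie in the chart image.\<close>

definition leaf_traces :: "('a, 'n) chart \<Rightarrow> (complex^'n) set \<Rightarrow> 'a \<Rightarrow> (complex^'n) set" where
  "leaf_traces c V q =
    (\<lambda>a. mix J (snd c a) 0) ` {a \<in> connected_component_of_set Lt q \<inter> fst c. snd c a \<in> V}"

text \<open>Distinct holonomy germs move almost every point of the disc to distinct plaques, but a leaf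
  through \<open>S\<close> offers at most \<open>n\<close> of them.\<close>

lemma finite_holonomy_group:
  assumes c: "c \<in> F" and p: "p \<in> fst c" and V: "open V" "snd c p \<in> V"
    and S: "S \<subseteq> snd c ` fst c"
    and count: "\<And>z. z \<in> S \<Longrightarrow>
      finite (leaf_traces c V (inv_chart c z)) \<and> card (leaf_traces c V (inv_chart c z)) \<le> n"
    and dense: "\<And>N. open N \<Longrightarrow> snd c p \<in> N \<Longrightarrow> \<not> negligible (S \<inter> N)"
  shows "finite (holonomy_group X J F (transverse_disc J c p) p)"
proof (rule ccontr)
  let ?D = "transverse_disc J c p" and ?disc = "\<lambda>z. inv_chart c (mix J z (snd c p))"
  let ?z0 = "snd c p"
  assume "\<not> finite (holonomy_group X J F ?D p)"
  then obtain B where B: "finite B" "card B = Suc n" "B \<subseteq> holonomy_group X J F ?D p"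
    using infinite_arbitrarily_large by blast
  have pD: "p \<in> ?D" and pX: "p \<in> topspace X"
    using p center_in_disc[OF p] chart_subset[OF c] by auto
  have "\<forall>g\<in>B. \<exists>h. g = germ X ?D p h \<and> filterlim h (nhds_on X ?D p) (nhds_on X ?D p) \<and>
      (\<forall>\<^sub>F q in nhds_on X ?D p. connected_component_of Lt q (h q)) \<and>
      holo_near (\<lambda>z. snd c (h (?disc z))) ?z0"
  proof
    fix g assume "g \<in> B"
    then obtain \<gamma> h where gh: "g = germ X ?D p h" "\<gamma> 0 = p" "\<gamma> 1 = p" "holonomy_along X J F \<gamma> ?D ?D h"
      using B(3) unfolding holonomy_group_def by blast
    have "holo_near (\<lambda>z. snd c (h (?disc z))) ?z0"
      by (rule holonomy_along_holomorphic[OF gh(4) c p gh(2) c]) (simp_all add: gh p)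
    then show "\<exists>h. g = germ X ?D p h \<and> filterlim h (nhds_on X ?D p) (nhds_on X ?D p) \<and>
      (\<forall>\<^sub>F q in nhds_on X ?D p. connected_component_of Lt q (h q)) \<and>
      holo_near (\<lambda>z. snd c (h (?disc z))) ?z0"
      using holonomy_along_germ[OF gh(4)] gh by (intro exI[of _ h]) simp
  qed
  from bchoice[OF this] obtain h where hB: "\<forall>g\<in>B. g = germ X ?D p (h g) \<and>
      filterlim (h g) (nhds_on X ?D p) (nhds_on X ?D p) \<and>
      (\<forall>\<^sub>F q in nhds_on X ?D p. connected_component_of Lt q (h g q)) \<and>
      holo_near (\<lambda>z. snd c (h g (?disc z))) ?z0" ..
  then have h: "g = germ X ?D p (h g)" "filterlim (h g) (nhds_on X ?D p) (nhds_on X ?D p)"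
    "\<forall>\<^sub>F q in nhds_on X ?D p. connected_component_of Lt q (h g q)"
    "holo_near (\<lambda>z. snd c (h g (?disc z))) ?z0" if "g \<in> B" for g
    using that by blast+
  define H where "H g z = snd c (h g (?disc z))" for g z
  note disc = filterlim_disc[OF c p]
  have "\<forall>\<^sub>F z in nhds ?z0. \<forall>g\<in>B. \<exists>T. open T \<and> z \<in> T \<and> H g cn_holomorphic_on T"
  proof (intro eventually_ball_finite B(1) ballI)
    fix g assume "g \<in> B"
    then obtain T where "open T" "?z0 \<in> T" "H g cn_holomorphic_on T"
      using h(4)[of g] unfolding holo_near_def H_def[abs_def] by blast
    then show "\<forall>\<^sub>F z in nhds ?z0. \<exists>T. open T \<and> z \<in> T \<and> H g cn_holomorphic_on T"
      unfolding eventually_nhds by blast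
  qed
  moreover have "\<forall>\<^sub>F z in nhds ?z0. \<forall>g\<in>B. h g (?disc z) \<in> ?D \<and>
      h g (?disc z) \<in> {y \<in> fst c. snd c y \<in> V} \<and> connected_component_of Lt (?disc z) (h g (?disc z))"
  proof (intro eventually_ball_finite B(1) ballI eventually_conj)
    fix g assume g: "g \<in> B"
    have lim: "filterlim (\<lambda>z. h g (?disc z)) (nhds_on X ?D p) (nhds ?z0)"
      using filterlim_compose[OF h(2)[OF g] disc] .
    show "\<forall>\<^sub>F z in nhds ?z0. h g (?disc z) \<in> ?D"
      using eventually_compose_filterlim[OF eventually_nhds_on_in lim] .
    have "\<forall>\<^sub>F q in nhds_on X ?D p. q \<in> {y \<in> fst c. snd c y \<in> V}"
      using p V(2) by (intro eventually_on_open chart_vimage_open c V(1)) auto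
    from eventually_compose_filterlim[OF this lim]
    show "\<forall>\<^sub>F z in nhds ?z0. h g (?disc z) \<in> {y \<in> fst c. snd c y \<in> V}" .
    show "\<forall>\<^sub>F z in nhds ?z0. connected_component_of Lt (?disc z) (h g (?disc z))"
      using eventually_compose_filterlim[OF h(3)[OF g] disc] .
  qed
  ultimately have "\<forall>\<^sub>F z in nhds ?z0. \<forall>g\<in>B. (\<exists>T. open T \<and> z \<in> T \<and> H g cn_holomorphic_on T) \<and>
      h g (?disc z) \<in> ?D \<and> h g (?disc z) \<in> {y \<in> fst c. snd c y \<in> V} \<and>
      connected_component_of Lt (?disc z) (h g (?disc z))"
    by eventually_elim simp
  then obtain N where N: "open N" "?z0 \<in> N" "\<And>z g. z \<in> N \<Longrightarrow> g \<in> B \<Longrightarrow>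
      (\<exists>T. open T \<and> z \<in> T \<and> H g cn_holomorphic_on T) \<and>
      h g (?disc z) \<in> ?D \<and> h g (?disc z) \<in> {y \<in> fst c. snd c y \<in> V} \<and>
      connected_component_of Lt (?disc z) (h g (?disc z))"
    unfolding eventually_nhds by meson
  obtain e where e: "e > 0" "polydisc ?z0 (\<lambda>_. e) \<subseteq> N"
    using polydisc_in_open[OF N(1,2)] .
  let ?P = "polydisc ?z0 (\<lambda>_. e)"
  have z0P: "?z0 \<in> ?P" using e(1) by (simp add: polydisc_def)
  have hol: "H g cn_holomorphic_on ?P" if "g \<in> B" for g
    using N(3)[OF _ that] e(2) unfolding cn_holomorphic_on_def by blast
  define Q where "Q = {(g, g'). g \<in> B \<and> g' \<in> B \<and> g \<noteq> g'}"
  have "finite Q" using B(1) by (auto simp: Q_def intro: finite_subset[of _ "B \<times> B"])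
  \<comment> \<open>The point of the manifold with coordinates \<open>z\<close> need not lie on the
    disc; \<open>?disc z\<close> is where its plaque meets the disc, so it stays in the same leaf.
    The \<open>Suc n\<close> images of \<open>?disc z\<close> then compete for at most
    \<open>n\<close> labels.\<close>
  have "S \<inter> ?P \<subseteq> (\<Union>(g, g')\<in>Q. {z \<in> ?P. H g z - H g' z = 0})"
  proof
    fix z assume z: "z \<in> S \<inter> ?P"
    then obtain q where q: "q \<in> fst c" "z = snd c q" using S by blast
    have qz: "inv_chart c z = q" using c q by simp
    have "?disc z = proj c p q" by (simp add: proj_def q)
    then have "connected_component_of Lt q (?disc z)"
      using same_plaque_connected[OF c same_plaque_proj[OF c q(1) p]] by simp
    then have "mix J (H g z) 0 \<in> leaf_traces c V q" if "g \<in> B" for g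
      using N(3)[OF _ that, of z] z e(2) connected_component_of_trans[of Lt q "?disc z" "h g (?disc z)"]
      unfolding leaf_traces_def H_def by (intro image_eqI[OF refl]) auto
    then have "card ((\<lambda>g. mix J (H g z) 0) ` B) \<le> card (leaf_traces c V q)"
      using count[of z] z by (intro card_mono) (auto simp: qz)
    also have "\<dots> < card B" using count[of z] z B(2) by (auto simp: qz)
    finally obtain g g' where g: "g \<in> B" "g' \<in> B" "g \<noteq> g'" "mix J (H g z) 0 = mix J (H g' z) 0"
      using pigeonhole unfolding inj_on_def by blast
    \<comment> \<open>The images lie on the disc, where the leafwise coordinates are those of
      \<open>p\<close>; hence equal plaque labels force equal points.\<close>
    have mix_H: "mix J (H k z) (snd c p) = H k z" if "k \<in> B" for k
      unfolding H_def by (rule mix_chart_disc) (use N(3)[OF _ that, of z] z e(2) in blast)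
    have "mix J (H g z) (snd c p) = mix J (H g' z) (snd c p)"
      using arg_cong[OF g(4), of "\<lambda>v. mix J v (snd c p)"] by simp
    then have "H g z - H g' z = 0" unfolding mix_H[OF g(1)] mix_H[OF g(2)] by simp
    moreover have "(g, g') \<in> Q" using g by (simp add: Q_def)
    ultimately show "z \<in> (\<Union>(g, g')\<in>Q. {z \<in> ?P. H g z - H g' z = 0})"
      using z by (intro UN_I[of "(g, g')"]) simp_all
  qed
  moreover have "\<not> negligible (S \<inter> ?P)" using dense[OF open_polydisc z0P] .
  ultimately have "\<not> negligible (\<Union>(g, g')\<in>Q. {z \<in> ?P. H g z - H g' z = 0})"
    using negligible_subset by blast
  then have "\<not> (\<forall>t\<in>Q. negligible (case t of (g, g') \<Rightarrow> {z \<in> ?P. H g z - H g' z = 0}))"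
    using negligible_Union[OF finite_imageI[OF \<open>finite Q\<close>]] by blast
  then obtain g g' where g: "g \<in> B" "g' \<in> B" "g \<noteq> g'"
    and nn: "\<not> negligible {z \<in> ?P. H g z - H g' z = 0}"
    by (auto simp: Q_def)
  have "(\<lambda>z. H g z - H g' z) cn_holomorphic_on ?P"
    using hol g by (intro cn_holomorphic_on_diff) auto
  then have eq: "H g z = H g' z" if "z \<in> ?P" for z
    using cn_holomorphic_zero_set_negligible[OF _ that] nn by force
  have "\<forall>\<^sub>F q in nhds_on X ?D p. h g q = h g' q"
  proof -
    have "\<forall>\<^sub>F q in nhds_on X ?D p. q \<in> {y \<in> fst c. snd c y \<in> ?P}"
      using p z0P by (intro eventually_on_open chart_vimage_open c open_polydisc) auto
    then show ?thesis using eventually_nhds_on_in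
    proof eventually_elim
      case (elim q)
      have "?disc (snd c q) = q" using proj_disc[OF c elim(2)] by (simp add: proj_def)
      then have "snd c (h g q) = snd c (h g' q)" "h g q \<in> fst c" "h g' q \<in> fst c"
        using eq[of "snd c q"] elim(1) N(3)[of "snd c q"] g e(2) by (auto simp: H_def)
      then show ?case using chart_inj[OF c] by (auto dest: inj_onD)
    qed
  qed
  then have "germ X ?D p (h g) = germ X ?D p (h g')"
    using germ_eq_iff[OF pX] by blast
  then show False using h(1) g by metis
qed

lemma positive_measure_imp_stable_leaf:
  assumes pos: "positive_measure X A (\<Omega> X J F)"
  shows "\<exists>L. compact_leaf X J F L \<and> stable_leaf X J F L"
proof -
  \<comment> \<open>The foliated charts themselves form a cover by coordinate charts, so null traces
    in all of them would give zero measure.\<close>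
  have "\<exists>c\<in>F. \<not> negligible (snd c ` (fst c \<inter> \<Omega> X J F))"
  proof (rule ccontr)
    assume "\<not> ?thesis"
    then have "\<forall>(U, \<phi>)\<in>F. \<phi> ` (U \<inter> \<Omega> X J F) \<in> null_sets lebesgue"
      by (force simp: negligible_iff_null_sets)
    then have "zero_measure X A (\<Omega> X J F)"
      using foliation unfolding holomorphic_foliation_def zero_measure_def by (intro exI[of _ F]) auto
    with pos show False by blast
  qed
  then obtain c where c: "c \<in> F" and nn: "\<not> negligible (snd c ` (fst c \<inter> \<Omega> X J F))" by blast
  define S0 where "S0 = snd c ` (fst c \<inter> \<Omega> X J F)"
  obtain p0 where p0: "p0 \<in> S0" "\<And>N. open N \<Longrightarrow> p0 \<in> N \<Longrightarrow> \<not> negligible (S0 \<inter> N)"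
    using not_negligible_point[of S0] nn unfolding S0_def by blast
  obtain r where r: "r > 0" "cball p0 r \<subseteq> snd c ` fst c"
    using chart_image_open[OF c] p0(1) open_contains_cball[of "snd c ` fst c"]
    by (auto simp: S0_def)
  \<comment> \<open>The closed ball supplies the compactness for counting plaques, the open one the
    neighbourhood that confines nearby holonomy images.\<close>
  define V where "V = ball p0 r"
  have traces: "finite (leaf_traces c V (inv_chart c z))" if z: "z \<in> S0" for z
  proof -
    obtain q L where q: "q \<in> fst c" "z = snd c q" "q \<in> L" "compact_leaf X J F L"
      using z unfolding S0_def compact_leaves_union_def by blast
    have "L = connected_component_of_set Lt q"
      using leaf_eq q(3,4) by (auto simp: compact_leaf_def)
    then have "leaf_traces c V q \<subseteq> (\<lambda>a. mix J (snd c a) 0) ` {a \<in> L \<inter> fst c. snd c a \<in> cball p0 r}"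
      unfolding leaf_traces_def V_def by auto
    then have "finite (leaf_traces c V q)"
      using compact_leaf_finite_plaques[OF q(4) c compact_cball r(2)] finite_subset by blast
    then show ?thesis using c q by simp
  qed
  \<comment> \<open>Each count is finite but there is no common bound; some level of this countable
    exhaustion of \<open>S0 \<inter> V\<close> is not negligible and supplies one.\<close>
  define S where "S n = {z \<in> S0 \<inter> V. card (leaf_traces c V (inv_chart c z)) \<le> n}" for n
  have "\<not> negligible (\<Union>n. S n)"
  proof -
    have "(\<Union>n. S n) = S0 \<inter> V" by (auto simp: S_def)
    then show ?thesis using p0(2)[of V] r(1) by (simp add: V_def)
  qed
  then obtain n where "\<not> negligible (S n)"
    using negligible_Union_nat[of S] by blast
  \<comment> \<open>The point is taken in \<open>S n\<close> itself, so that it lies on a compact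
    leaf; that leaf is the stable one.\<close>
  then obtain z where z: "z \<in> S n" "\<And>N. open N \<Longrightarrow> z \<in> N \<Longrightarrow> \<not> negligible (S n \<inter> N)"
    using not_negligible_point by blast
  then obtain p L where p: "p \<in> fst c" "z = snd c p" "p \<in> L" "compact_leaf X J F L"
    by (auto simp: S_def S0_def compact_leaves_union_def)
  have "finite (holonomy_group X J F (transverse_disc J c p) p)"
  proof (rule finite_holonomy_group[OF c p(1), of V "S n" n])
    show "open V" "snd c p \<in> V" "S n \<subseteq> snd c ` fst c"
      using z(1) p(2) by (auto simp: V_def S_def S0_def)
    show "finite (leaf_traces c V (inv_chart c z)) \<and> card (leaf_traces c V (inv_chart c z)) \<le> n"
      if "z \<in> S n" for z
      using that traces by (simp add: S_def)
    show "\<not> negligible (S n \<inter> N)" if "open N" "snd c p \<in> N" for N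
      using z(2) that p(2) by blast
  qed
  then have "stable_leaf X J F L"
    using p(1,3) c unfolding stable_leaf_def transverse_disc_at_def by blast
  then show ?thesis using p(4) by blast
qed

end

section \<open>Local stability\<close>

lemma finite_image_factor:
  assumes "finite (\<Phi> ` R)" and "\<And>a b. a \<in> R \<Longrightarrow> b \<in> R \<Longrightarrow> \<Phi> a = \<Phi> b \<Longrightarrow> \<Psi> a = \<Psi> b"
  shows "finite (\<Psi> ` R)"
proof -
  have "\<Psi> ` R \<subseteq> (\<lambda>v. \<Psi> (inv_into R \<Phi> v)) ` \<Phi> ` R"
  proof
    fix w assume "w \<in> \<Psi> ` R"
    then obtain a where a: "a \<in> R" "w = \<Psi> a" by blast
    then have "\<Psi> (inv_into R \<Phi> (\<Phi> a)) = \<Psi> a"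
      by (intro assms(2)) (auto simp: inv_into_into f_inv_into_f)
    then show "w \<in> (\<lambda>v. \<Psi> (inv_into R \<Phi> v)) ` \<Phi> ` R" using a
      by (intro image_eqI[of _ _ "\<Phi> a"]) auto
  qed
  then show ?thesis using assms(1) finite_surj by blast
qed

text \<open>A tube argument: a finite subcover of \<open>K\<close> turns the conditions on
  \<open>q\<close>, given locally in \<open>y\<close>, into a single one.\<close>

lemma eventually_compactin:
  assumes K: "compactin X K"
    and loc: "\<And>z. z \<in> K \<Longrightarrow> \<exists>N. openin X N \<and> z \<in> N \<and> (\<forall>\<^sub>F q in G. \<forall>y\<in>N. P q y)"
  shows "\<forall>\<^sub>F q in G. \<forall>y\<in>K. P q y"
proof -
  define \<U> where "\<U> = {N. openin X N \<and> (\<forall>\<^sub>F q in G. \<forall>y\<in>N. P q y)}"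
  have "K \<subseteq> \<Union>\<U>" using loc unfolding \<U>_def by blast
  then have "\<exists>\<F>. finite \<F> \<and> \<F> \<subseteq> \<U> \<and> K \<subseteq> \<Union>\<F>"
    by (rule compactinD[OF K, rotated]) (simp add: \<U>_def)
  then obtain \<F> where \<F>: "finite \<F>" "\<F> \<subseteq> \<U>" "K \<subseteq> \<Union>\<F>" by (elim exE conjE)
  then have "\<forall>\<^sub>F q in G. \<forall>N\<in>\<F>. \<forall>y\<in>N. P q y"
    by (intro eventually_ball_finite) (auto simp: \<U>_def)
  then show ?thesis
    by eventually_elim (use \<F>(3) in blast)
qed

lemma open_not_negligible:
  fixes S :: "'a::euclidean_space set"
  assumes "open S" "x \<in> S"
  shows "\<not> negligible S"
proof
  assume neg: "negligible S"
  obtain r where r: "r > 0" "ball x r \<subseteq> S" using assms openE by blast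
  have "measure lebesgue (ball x r) = 0"
    using negligible_imp_measure0[OF negligible_subset[OF neg r(2)]] .
  then show False using content_ball_pos[OF r(1), of x] by simp
qed

context foliated_manifold
begin

section \<open>Holonomy germs with varying endpoint\<close>

definition reach :: "'a \<Rightarrow> 'a set \<Rightarrow> 'a \<Rightarrow> 'a set \<Rightarrow> ('a \<Rightarrow> 'a) \<Rightarrow> bool" where
  "reach x D y E h \<longleftrightarrow>
    (\<exists>\<gamma>. pathin Lt \<gamma> \<and> \<gamma> 0 = x \<and> \<gamma> 1 = y \<and> holonomy_along X J F \<gamma> D E h)"

definition germs :: "'a \<Rightarrow> 'a set \<Rightarrow> 'a \<Rightarrow> 'a set \<Rightarrow> ('a \<Rightarrow> 'a) set set" where
  "germs x D y E = germ X D x ` {h. reach x D y E h}"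

lemma holonomy_group_eq_germs: "holonomy_group X J F D x = germs x D x D"
  unfolding holonomy_group_def germs_def reach_def by auto

lemma reach_filterlim: "reach x D y E h \<Longrightarrow> filterlim h (nhds_on X E y) (nhds_on X D x)"
  unfolding reach_def using holonomy_along_germ by blast

text \<open>A partition running from 0 to 1 has at least one piece, so the constant path is used
  with one piece and the identity as its slide.\<close>

lemma reach_refl:
  assumes D: "transverse_disc_at J F x D"
  shows "reach x D x D id"
proof -
  obtain c where c: "c \<in> F" "x \<in> fst c" "D = transverse_disc J c x"
    using D by (auto simp: transverse_disc_at_def)
  have "plaque_holonomy X J c D x D x id"
    unfolding plaque_holonomy_def
  proof (intro conjI exI[of _ "fst c"])
    show "continuous_map (subtopology X (fst c \<inter> D)) (subtopology X D) id"
      by (simp add: continuous_map_in_subtopology continuous_map_from_subtopology)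
    show "openin X (fst c)" "x \<in> fst c" "id x = x" using c chart_open by auto
    show "\<forall>p\<in>fst c \<inter> D. same_plaque J c p (id p)" by (simp add: same_plaque_refl)
  qed
  then have "holonomy_along X J F (\<lambda>_. x) D D id"
    unfolding holonomy_along_def using c D
    by (intro exI[of _ "1::nat"] exI[of _ real] exI[of _ "\<lambda>_. c"] exI[of _ "\<lambda>_. D"] exI[of _ "\<lambda>_. id"]) auto
  then show ?thesis
    unfolding reach_def using transverse_disc_at_topspace[OF D] by (intro exI[of _ "\<lambda>_. x"]) simp
qed

lemma reach_step:
  assumes yE: "reach x D y E h" and c: "c \<in> F" and yz: "same_plaque J c y z"
    and E': "transverse_disc_at J F z E'" and g: "plaque_holonomy X J c E y E' z g"
  shows "reach x D z E' (g \<circ> h)"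
proof -
  obtain \<gamma> where \<gamma>: "pathin Lt \<gamma>" "\<gamma> 0 = x" "\<gamma> 1 = y" "holonomy_along X J F \<gamma> D E h"
    using yE by (auto simp: reach_def)
  obtain k t C T f where
    t: "t 0 = 0" "t k = 1" and T: "T 0 = D" "T k = E"
    and disc: "\<And>j. j \<le> k \<Longrightarrow> transverse_disc_at J F (\<gamma> (t j)) (T j)"
    and sl: "\<And>j. j < k \<Longrightarrow> t j < t (Suc j) \<and> C j \<in> F \<and> \<gamma> ` {t j..t (Suc j)} \<subseteq> fst (C j) \<and>
        plaque_holonomy X J (C j) (T j) (\<gamma> (t j)) (T (Suc j)) (\<gamma> (t (Suc j))) (f j)"
    and h: "h = fold (\<lambda>j g. f j \<circ> g) [0..<k::nat] id"
    using \<gamma>(4) unfolding holonomy_along_def by blast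
  \<comment> \<open>The joined path switches branch at 1/2, so evaluating it at the halved times
    requires that the old times do not exceed 1.\<close>
  have t_le: "t j \<le> 1" if "j \<le> k" for j
    using that
  proof (induction rule: inc_induct)
    case (step n)
    then show ?case using sl[of n] by linarith
  qed (use t in simp)
  obtain \<delta> where \<delta>: "pathin Lt \<delta>" "\<delta> 0 = y" "\<delta> 1 = z" "\<delta> ` {0..1} \<subseteq> fst c"
    using plaque_path[OF c yz] .
  define \<gamma>' where "\<gamma>' s = (if s \<le> 1/2 then \<gamma> (2 * s) else \<delta> (2 * s - 1))" for s :: real
  \<comment> \<open>The old partition is squeezed into [0,1/2], so \<open>t' k = 1/2\<close>; index
    \<open>Suc k\<close> is the new endpoint 1.\<close>
  define t' where "t' j = (if j \<le> k then t j / 2 else 1)" for j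
  define C' where "C' j = (if j < k then C j else c)" for j
  define T' where "T' j = (if j \<le> k then T j else E')" for j
  define f' where "f' j = (if j < k then f j else g)" for j
  have \<gamma>'_t: "\<gamma>' (t' j) = \<gamma> (t j)" if "j \<le> k" for j
    using t_le[OF that] that by (simp add: \<gamma>'_def t'_def)
  have \<gamma>'_1: "\<gamma>' (t' (Suc k)) = z" "\<gamma>' (t' k) = y" "t' (Suc k) = 1" "t' k = 1/2"
    using \<delta>(3) \<gamma>(3) t by (simp_all add: \<gamma>'_def t'_def)
  have "fold (\<lambda>j g. f' j \<circ> g) [0..<k] id = h"
    unfolding h by (intro fold_cong) (auto simp: f'_def)
  then have comp: "g \<circ> h = fold (\<lambda>j g. f' j \<circ> g) [0..<Suc k] id"
    by (simp add: f'_def)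
  have pieces: "t' j < t' (Suc j) \<and> C' j \<in> F \<and> \<gamma>' ` {t' j..t' (Suc j)} \<subseteq> fst (C' j) \<and>
      plaque_holonomy X J (C' j) (T' j) (\<gamma>' (t' j)) (T' (Suc j)) (\<gamma>' (t' (Suc j))) (f' j)"
    if j: "j < Suc k" for j
  proof (cases "j < k")
    case True
    have "\<gamma>' s \<in> fst (C j)" if s: "s \<in> {t j / 2..t (Suc j) / 2}" for s
    proof -
      have "s \<le> 1/2" using s t_le[of "Suc j"] True by auto
      then have "\<gamma>' s = \<gamma> (2 * s)" by (simp add: \<gamma>'_def)
      moreover have "2 * s \<in> {t j..t (Suc j)}" using s by auto
      ultimately show ?thesis using sl[OF True] by auto
    qed
    then show ?thesis
      using sl[OF True] True \<gamma>'_t[of j] \<gamma>'_t[of "Suc j"]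
      by (auto simp: t'_def C'_def T'_def f'_def)
  next
    case False
    then have [simp]: "j = k" using j by simp
    have "\<gamma>' s \<in> fst c" if s: "s \<in> {1/2..1}" for s
    proof (cases "s = 1/2")
      case True
      then have "\<gamma>' s = y" using \<gamma>'_1(2,4) by (simp only:)
      then show ?thesis using yz by (simp add: same_plaque_def)
    next
      case False
      then have "\<gamma>' s = \<delta> (2 * s - 1)" "2 * s - 1 \<in> {0..1}" using s by (auto simp: \<gamma>'_def)
      then show ?thesis using \<delta>(4) by auto
    qed
    then have "\<gamma>' ` {t' k..t' (Suc k)} \<subseteq> fst c" unfolding \<gamma>'_1(3,4) by blast
    moreover have "plaque_holonomy X J c E (\<gamma>' (t' k)) E' (\<gamma>' (t' (Suc k))) g"
      unfolding \<gamma>'_1(1,2) by (rule g)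
    moreover have "t' k < t' (Suc k)" unfolding \<gamma>'_1(3,4) by simp
    ultimately show ?thesis
      using c T by (simp add: C'_def T'_def f'_def)
  qed
  have "holonomy_along X J F \<gamma>' D E' (g \<circ> h)"
    unfolding holonomy_along_def
  proof (intro exI conjI)
    show "t' 0 = 0" "t' (Suc k) = 1" "T' 0 = D" "T' (Suc k) = E'"
      using t T by (simp_all add: t'_def T'_def)
    show "\<forall>j\<le>Suc k. transverse_disc_at J F (\<gamma>' (t' j)) (T' j)"
    proof (intro allI impI)
      fix j assume "j \<le> Suc k"
      then consider "j \<le> k" | "j = Suc k" by linarith
      then show "transverse_disc_at J F (\<gamma>' (t' j)) (T' j)"
        by cases (use disc E' \<gamma>'_t \<gamma>'_1 in \<open>simp_all add: T'_def\<close>)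
    qed
    show "\<forall>j<Suc k. t' j < t' (Suc j) \<and> C' j \<in> F \<and> \<gamma>' ` {t' j..t' (Suc j)} \<subseteq> fst (C' j) \<and>
      plaque_holonomy X J (C' j) (T' j) (\<gamma>' (t' j)) (T' (Suc j)) (\<gamma>' (t' (Suc j))) (f' j)"
      using pieces by blast
    show "g \<circ> h = fold (\<lambda>j g. f' j \<circ> g) [0..<Suc k] id" by (rule comp)
  qed
  moreover have "pathin Lt \<gamma>'"
    using pathin_join[OF \<gamma>(1) \<delta>(1)] \<gamma>(3) \<delta>(2) unfolding \<gamma>'_def[abs_def] by simp
  moreover have "\<gamma>' 0 = x" "\<gamma>' 1 = z" using \<gamma>(2) \<delta>(3) by (simp_all add: \<gamma>'_def)
  ultimately show ?thesis unfolding reach_def by blast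
qed

text \<open>Composition with the slide back to \<open>y\<close> maps germs ending at
  \<open>z\<close> to germs ending at \<open>y\<close>. It is injective on germs:
  \<open>b \<circ> f\<close> slides the disc \<open>E'\<close> to itself in one chart, so by
  uniqueness it has the germ of the identity. The case \<open>y = z\<close> changes the
  disc.\<close>

lemma finite_germs_step:
  assumes D: "transverse_disc_at J F x D" and E: "transverse_disc_at J F y E"
    and E': "transverse_disc_at J F z E'" and c: "c \<in> F" and yz: "same_plaque J c y z"
    and fin: "finite (germs x D y E)"
  shows "finite (germs x D z E')"
proof -
  obtain e where e: "e \<in> F" "y \<in> fst e" "E = transverse_disc J e y"
    using E by (auto simp: transverse_disc_at_def)
  obtain e' where e': "e' \<in> F" "z \<in> fst e'" "E' = transverse_disc J e' z"
    using E' by (auto simp: transverse_disc_at_def)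
  have zy: "same_plaque J c z y" using yz by (rule same_plaque_sym)
  have xX: "x \<in> topspace X" using D by (rule transverse_disc_at_topspace)
  have yE: "y \<in> E" "y \<in> topspace X" and zE': "z \<in> E'" "z \<in> topspace X"
    using E E' transverse_disc_at_center transverse_disc_at_topspace by auto
  define f where "f = proj e y \<circ> proj c y"
  define b where "b = proj e' z \<circ> proj c z"
  have f: "plaque_holonomy X J c E' z E y f"
    unfolding f_def e(3) by (rule plaque_holonomy_proj[OF c e(1) zy e(2)])
  have b: "plaque_holonomy X J c E y E' z b"
    unfolding b_def e'(3) by (rule plaque_holonomy_proj[OF c e'(1) yz e'(2)])
  have "slide c E' z E' z (b \<circ> f)"
    using plaque_holonomy_imp_slide[OF zE' f] plaque_holonomy_imp_slide[OF yE b]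
    by (rule slide_compose)
  moreover have "slide c E' z E' z id"
  proof -
    have "\<forall>\<^sub>F q in nhds_on X E' z. q \<in> fst c"
      using yz by (intro eventually_on_open chart_open c) (simp add: same_plaque_def)
    then have "\<forall>\<^sub>F q in nhds_on X E' z. same_plaque J c q (id q)"
      by eventually_elim (simp add: same_plaque_refl)
    then show ?thesis by (simp add: slide_def filterlim_ident id_def)
  qed
  ultimately have bf: "\<forall>\<^sub>F q in nhds_on X E' z. (b \<circ> f) q = id q"
    unfolding e'(3)
    by (rule slide_unique[OF c e'(1) zE'(1)[unfolded e'(3)] zE'(2) e'(2)])
  have "germ X D x ` (\<lambda>h. f \<circ> h) ` {h. reach x D z E' h} \<subseteq> germs x D y E"
    unfolding germs_def using reach_step[OF _ c zy E f] by blast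
  then have fin': "finite ((\<lambda>h. germ X D x (f \<circ> h)) ` {h. reach x D z E' h})"
    using fin finite_subset by (simp add: image_image)
  show ?thesis
    unfolding germs_def
  proof (rule finite_image_factor[OF fin'])
    fix h1 h2 assume h: "h1 \<in> {h. reach x D z E' h}" "h2 \<in> {h. reach x D z E' h}"
      and eq: "germ X D x (f \<circ> h1) = germ X D x (f \<circ> h2)"
    have "\<forall>\<^sub>F q in nhds_on X D x. b (f (h q)) = h q" if "reach x D z E' h" for h
      using eventually_compose_filterlim[OF bf reach_filterlim[OF that]] by simp
    then have "\<forall>\<^sub>F q in nhds_on X D x. b (f (h1 q)) = h1 q"
      "\<forall>\<^sub>F q in nhds_on X D x. b (f (h2 q)) = h2 q"
      using h by simp_all
    moreover have "\<forall>\<^sub>F q in nhds_on X D x. (f \<circ> h1) q = (f \<circ> h2) q"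
      using eq germ_eq_iff[OF xX] by blast
    ultimately have "\<forall>\<^sub>F q in nhds_on X D x. h1 q = h2 q"
      by eventually_elim (metis o_apply)
    then show "germ X D x h1 = germ X D x h2" using germ_eq_iff[OF xX] by blast
  qed
qed

text \<open>The points with finitely many germs for every disc form a union of plaques, and so does
  the complement. Both are leaf-open, and the connected leaf \<open>L\<close> cannot meet
  both.\<close>

lemma finite_germs_leaf:
  assumes L: "L \<in> leaves X J F" and x: "x \<in> L" and D: "transverse_disc_at J F x D"
    and fin: "finite (holonomy_group X J F D x)"
    and y: "y \<in> L" and E: "transverse_disc_at J F y E"
  shows "finite (germs x D y E)"
proof -
  define G where "G = {y. \<forall>E. transverse_disc_at J F y E \<longrightarrow> finite (germs x D y E)}"
  have sat: "z \<in> G" if "c \<in> F" "same_plaque J c y z" "y \<in> G" for c y z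
  proof -
    have "transverse_disc_at J F y (transverse_disc J c y)"
      using that by (auto simp: transverse_disc_at_def same_plaque_def)
    then show ?thesis using that finite_germs_step[OF D _ _ that(1,2)] by (auto simp: G_def)
  qed
  have sat': "plaque J c y \<subseteq> G \<or> plaque J c y \<subseteq> - G" if "c \<in> F" for c y
    using sat[OF that] same_plaque_sym same_plaque_trans
    by (metis (no_types, lifting) Compl_iff mem_Collect_eq subsetI)
  have "openin Lt (topspace X \<inter> S)" if S: "S = G \<or> S = - G" for S
  proof (subst openin_subopen, intro ballI)
    fix y assume y: "y \<in> topspace X \<inter> S"
    then obtain c where c: "c \<in> F" "y \<in> fst c" using chart_exists by blast
    then have "topspace X \<inter> plaque J c y \<subseteq> topspace X \<inter> S"
      using sat'[OF c(1), of y] S y same_plaque_refl[OF c(2), of J] by blast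
    then show "\<exists>T. openin Lt T \<and> y \<in> T \<and> T \<subseteq> topspace X \<inter> S"
      using openin_Lt_plaque[OF c(1) openin_topspace] y same_plaque_refl[OF c(2)] by blast
  qed
  then have op: "openin Lt (topspace X \<inter> G)" "openin Lt (topspace X \<inter> - G)" by auto
  have conn: "connectedin Lt L"
    using L connectedin_connected_components_of unfolding leaves_def by blast
  have "x \<in> G"
  proof -
    obtain c where c: "c \<in> F" "x \<in> fst c" using D by (auto simp: transverse_disc_at_def)
    show ?thesis
      unfolding G_def using finite_germs_step[OF D D _ c(1) same_plaque_refl[OF c(2)]] fin
      by (auto simp: holonomy_group_eq_germs)
  qed
  have "y \<in> G"
  proof (rule ccontr)
    assume "y \<notin> G"
    then show False
      using conn op x y \<open>x \<in> G\<close> leaf_subset[OF L] unfolding connectedin by blast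
  qed
  then show ?thesis using E by (simp add: G_def)
qed

lemma compactin_plaque_piece:
  assumes c: "c \<in> F" and K: "compact K" "K \<subseteq> snd c ` fst c"
  shows "compactin Lt ({z \<in> fst c. snd c z \<in> K} \<inter> plaque J c y)"
proof (cases "y \<in> fst c")
  case True
  let ?P = "{w. agree_on J (snd c y) w}"
  have "?P = (\<Inter>i\<in>J. {w. snd c y $ i = w $ i})" by (auto simp: agree_on_def)
  moreover have "closed (\<Inter>i\<in>J. {w :: complex^'n. snd c y $ i = w $ i})"
    by (intro closed_INT ballI closed_Collect_eq continuous_intros)
  ultimately have "compact (K \<inter> ?P)" using K(1) compact_Int_closed by metis
  then have "compactin X {z \<in> fst c. snd c z \<in> K \<inter> ?P}"
    using K(2) by (intro chart_compact c) auto
  moreover have "{z \<in> fst c. snd c z \<in> K \<inter> ?P} = {z \<in> fst c. snd c z \<in> K} \<inter> plaque J c y"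
    using True by (auto simp: same_plaque_def)
  ultimately have "compactin (subtopology X (plaque J c y)) ({z \<in> fst c. snd c z \<in> K} \<inter> plaque J c y)"
    by (simp add: compactin_subtopology)
  then show ?thesis
    unfolding subtopology_plaque[OF c, symmetric] by (simp add: compactin_subtopology)
next
  case False
  then have "plaque J c y = {}" by (simp add: same_plaque_def)
  then show ?thesis by simp
qed

text \<open>The candidate for the leaf through a point \<open>q\<close> near \<open>x\<close> is the union of the pieces of plaques
  through the finitely many points \<open>h q\<close>, where \<open>h\<close> runs over representatives of the germs that lead
  from \<open>x\<close> to the centres of a finite cover of \<open>L\<close>; it is open and compact in the leaf topology.\<close>

lemma nearby_leaves_compact:
  assumes L: "compact_leaf X J F L" and x: "x \<in> L"
    and d: "d \<in> F" "x \<in> fst d" and D: "D = transverse_disc J d x"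
    and fin: "finite (holonomy_group X J F D x)"
  shows "\<forall>\<^sub>F q in nhds_on X D x. q \<in> \<Omega> X J F"
proof -
  have Lv: "L \<in> leaves X J F" and Lc: "compactin Lt L" using L by (auto simp: compact_leaf_def)
  have Dat: "transverse_disc_at J F x D" using d D by (auto simp: transverse_disc_at_def)
  have xX: "x \<in> topspace X" using Dat by (rule transverse_disc_at_topspace)
  \<comment> \<open>The chart at \<open>x\<close> is forced to be \<open>d\<close>, so that
    \<open>T x\<close> is the given disc \<open>D\<close> and the identity germ has a representative
    in \<open>H x\<close>; this later puts \<open>q\<close> into \<open>Q q\<close>.\<close>
  have "\<forall>y\<in>L. \<exists>c\<in>F. y \<in> fst c \<and> (y = x \<longrightarrow> c = d)"
  proof
    fix y assume "y \<in> L"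
    then show "\<exists>c\<in>F. y \<in> fst c \<and> (y = x \<longrightarrow> c = d)"
      using d chart_exists[of y] leaf_subset[OF Lv] by (cases "y = x") blast+
  qed
  from bchoice[OF this[unfolded Bex_def]]
  obtain e where "\<forall>y\<in>L. e y \<in> F \<and> y \<in> fst (e y) \<and> (y = x \<longrightarrow> e y = d)" ..
  then have ex: "e x = d" and e: "\<And>y. y \<in> L \<Longrightarrow> e y \<in> F" "\<And>y. y \<in> L \<Longrightarrow> y \<in> fst (e y)"
    using x by auto
  have "\<forall>y\<in>L. \<exists>r. r > 0 \<and> cball (snd (e y) y) r \<subseteq> snd (e y) ` fst (e y)"
  proof
    fix y assume "y \<in> L"
    then show "\<exists>r. r > 0 \<and> cball (snd (e y) y) r \<subseteq> snd (e y) ` fst (e y)"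
      using open_contains_cball[of "snd (e y) ` fst (e y)"] chart_image_open e by blast
  qed
  from bchoice[OF this] obtain r
    where "\<forall>y\<in>L. r y > 0 \<and> cball (snd (e y) y) (r y) \<subseteq> snd (e y) ` fst (e y)" ..
  then have r: "r y > 0" "cball (snd (e y) y) (r y) \<subseteq> snd (e y) ` fst (e y)" if "y \<in> L" for y
    using that by auto
  \<comment> \<open>The pieces \<open>B y\<close> serve for openness and the pieces
    \<open>K y\<close> for compactness of the candidate leaf; that they give the same union is the
    purpose of \<open>closure\<close>.\<close>
  define B where "B y = {z \<in> fst (e y). snd (e y) z \<in> ball (snd (e y) y) (r y)}" for y
  define K where "K y = {z \<in> fst (e y). snd (e y) z \<in> cball (snd (e y) y) (r y)}" for y
  define T where "T y = transverse_disc J (e y) y" for y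
  have BK: "B y \<subseteq> K y" for y by (auto simp: B_def K_def)
  have B_open: "openin X (B y)" "y \<in> B y" if "y \<in> L" for y
    unfolding B_def using e[OF that] r(1)[OF that] chart_vimage_open[of "e y" "ball (snd (e y) y) (r y)"]
    by simp_all
  have "\<exists>\<F>. finite \<F> \<and> \<F> \<subseteq> (\<lambda>y. B y \<inter> plaque J (e y) y) ` L \<and> L \<subseteq> \<Union>\<F>"
  proof (rule compactinD[OF Lc])
    show "openin Lt U" if "U \<in> (\<lambda>y. B y \<inter> plaque J (e y) y) ` L" for U
      using that e(1) B_open(1) openin_Lt_plaque by blast
    show "L \<subseteq> \<Union> ((\<lambda>y. B y \<inter> plaque J (e y) y) ` L)"
      using e(2) B_open(2) by (auto simp: same_plaque_refl)
  qed
  then obtain \<F> where \<F>: "finite \<F>" "\<F> \<subseteq> (\<lambda>y. B y \<inter> plaque J (e y) y) ` L" "L \<subseteq> \<Union>\<F>"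
    by (elim exE conjE)
  obtain Y0 where Y0: "Y0 \<subseteq> L" "finite Y0" "\<F> = (\<lambda>y. B y \<inter> plaque J (e y) y) ` Y0"
    using finite_subset_image[OF \<F>(1,2)] by blast
  define Y where "Y = insert x Y0"
  have Y: "finite Y" "Y \<subseteq> L" "x \<in> Y" using Y0 x by (auto simp: Y_def)
  have cover: "\<exists>y\<in>Y. z \<in> B y \<and> same_plaque J (e y) y z" if "z \<in> L" for z
    using \<F>(3) Y0(3) that by (auto simp: Y_def)
  have Tat: "transverse_disc_at J F y (T y)" if "y \<in> L" for y
    using e[OF that] by (auto simp: transverse_disc_at_def T_def)
  have "\<forall>y\<in>Y. \<exists>H. finite H \<and> H \<subseteq> {h. reach x D y (T y) h} \<and> germs x D y (T y) = germ X D x ` H"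
  proof
    fix y assume "y \<in> Y"
    then have "finite (germs x D y (T y))"
      using Y(2) by (intro finite_germs_leaf[OF Lv x Dat fin] Tat) auto
    then show "\<exists>H. finite H \<and> H \<subseteq> {h. reach x D y (T y) h} \<and> germs x D y (T y) = germ X D x ` H"
      unfolding germs_def using finite_subset_image[OF _ subset_refl] by metis
  qed
  from bchoice[OF this] obtain H where "\<forall>y\<in>Y. finite (H y) \<and> H y \<subseteq> {h. reach x D y (T y) h} \<and>
      germs x D y (T y) = germ X D x ` H y" ..
  then have H: "finite (H y)" "H y \<subseteq> {h. reach x D y (T y) h}"
      "germs x D y (T y) = germ X D x ` H y" if "y \<in> Y" for y
    using that by auto
  have H_rep: "\<exists>h'\<in>H y. \<forall>\<^sub>F q in nhds_on X D x. h q = h' q" if "y \<in> Y" "reach x D y (T y) h" for y h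
  proof -
    have "germ X D x h \<in> germ X D x ` H y"
      unfolding H(3)[OF that(1), symmetric] germs_def using that(2) by blast
    then show ?thesis using germ_eq_iff[OF xX] by blast
  qed
  define Q where "Q q = (\<Union>y\<in>Y. \<Union>h\<in>H y. B y \<inter> plaque J (e y) (h q))" for q
  \<comment> \<open>The heart of the argument: a plaque followed up to the rim of a piece is caught
    by another piece. Compactness of \<open>K y\<close> reduces this to a neighbourhood of one point
    \<open>z0\<close>.\<close>
  have closure: "\<forall>\<^sub>F q in nhds_on X D x. \<forall>z\<in>K y. same_plaque J (e y) (h q) z \<longrightarrow> z \<in> Q q"
    if yY: "y \<in> Y" and hH: "h \<in> H y" for y h
  proof (rule eventually_compactin[of X])
    have yL: "y \<in> L" using yY Y(2) by blast
    note ey = e[OF yL]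
    have reach_h: "reach x D y (T y) h" using H(2)[OF yY] hH by blast
    note lim_h = reach_filterlim[OF reach_h]
    show "compactin X (K y)"
      unfolding K_def by (rule chart_compact[OF ey(1) compact_cball r(2)[OF yL]])
    fix z0 assume z0: "z0 \<in> K y"
    then have z0e: "z0 \<in> fst (e y)" by (simp add: K_def)
    show "\<exists>N. openin X N \<and> z0 \<in> N \<and>
        (\<forall>\<^sub>F q in nhds_on X D x. \<forall>z\<in>N. same_plaque J (e y) (h q) z \<longrightarrow> z \<in> Q q)"
    proof (cases "same_plaque J (e y) y z0")
      \<comment> \<open>Some transverse coordinate separates \<open>z0\<close> from
        \<open>y\<close>. As \<open>h q\<close> tends to \<open>y\<close>, its plaque misses a
        neighbourhood of \<open>z0\<close>, where the claim is vacuous.\<close>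
      case False
      then obtain i where i: "i \<in> J" "snd (e y) y $ i \<noteq> snd (e y) z0 $ i"
        using z0e ey(2) by (auto simp: same_plaque_def agree_on_def)
      obtain U V where UV: "open U" "open V" "snd (e y) y $ i \<in> U" "snd (e y) z0 $ i \<in> V" "U \<inter> V = {}"
        using hausdorff[OF i(2)] by blast
      let ?M = "\<lambda>U. {z \<in> fst (e y). snd (e y) z \<in> (\<lambda>w. w $ i) -` U}"
      have M: "openin X (?M U)" if "open U" for U
        by (intro chart_vimage_open ey(1) open_vimage that continuous_intros)
      have "\<forall>\<^sub>F q in nhds_on X (T y) y. q \<in> ?M U"
        using M[OF UV(1)] UV(3) ey(2) by (intro eventually_on_open) auto
      from eventually_compose_filterlim[OF this lim_h]
      have "\<forall>\<^sub>F q in nhds_on X D x. \<forall>z\<in>?M V. same_plaque J (e y) (h q) z \<longrightarrow> z \<in> Q q"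
      proof eventually_elim
        case (elim q)
        have "\<not> same_plaque J (e y) (h q) z" if "z \<in> ?M V" for z
          using elim that UV(5) i(1) by (auto simp: same_plaque_def agree_on_def)
        then show ?case by blast
      qed
      then show ?thesis
        using M[OF UV(2)] UV(4) z0e by (intro exI[of _ "?M V"]) simp
    next
      \<comment> \<open>Here \<open>z0\<close> belongs to \<open>L\<close>, hence to the piece
        around some centre \<open>y'\<close>. Continuing \<open>h\<close> through \<open>z0\<close>
        to \<open>y'\<close> gives a germ with a representative \<open>h'\<close> in
        \<open>H y'\<close>, so near \<open>z0\<close> the plaque of \<open>h q\<close> lies in the
        piece through \<open>h' q\<close>.\<close>
      case True
      then have z0L: "z0 \<in> L" using leaf_saturated[OF Lv yL ey(1)] by blast
      obtain y' where y': "y' \<in> Y" "z0 \<in> B y'" "same_plaque J (e y') y' z0"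
        using cover[OF z0L] by blast
      have y'L: "y' \<in> L" using y'(1) Y(2) by blast
      note ey' = e[OF y'L]
      have z0e': "z0 \<in> fst (e y')" using y'(3) by (simp add: same_plaque_def)
      let ?E = "transverse_disc J (e y) z0"
      \<comment> \<open>The repetition comes from \<open>plaque_holonomy_proj\<close> with the
        target disc in the sliding chart itself; the second projection fixes the result of the
        first.\<close>
      define f1 where "f1 = proj (e y) z0 \<circ> proj (e y) z0"
      define f2 where "f2 = proj (e y') y' \<circ> proj (e y') y'"
      have f1: "plaque_holonomy X J (e y) (T y) y ?E z0 f1"
        unfolding f1_def by (rule plaque_holonomy_proj[OF ey(1) ey(1) True z0e])
      have f2: "plaque_holonomy X J (e y') ?E z0 (T y') y' f2"
        unfolding f2_def T_def
        by (rule plaque_holonomy_proj[OF ey'(1) ey'(1) same_plaque_sym[OF y'(3)] ey'(2)])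
      have Eat: "transverse_disc_at J F z0 ?E"
        using ey(1) z0e by (auto simp: transverse_disc_at_def)
      have r1: "reach x D z0 ?E (f1 \<circ> h)"
        by (rule reach_step[OF reach_h ey(1) True Eat f1])
      have r2: "reach x D y' (T y') (f2 \<circ> (f1 \<circ> h))"
        by (rule reach_step[OF r1 ey'(1) same_plaque_sym[OF y'(3)] Tat[OF y'L] f2])
      obtain h' where h': "h' \<in> H y'" "\<forall>\<^sub>F q in nhds_on X D x. (f2 \<circ> (f1 \<circ> h)) q = h' q"
        using H_rep[OF y'(1) r2] by blast
      obtain N where N: "openin X N" "z0 \<in> N" "N \<subseteq> fst (e y)" "N \<subseteq> fst (e y')"
        "\<forall>a\<in>N. \<forall>b\<in>N. same_plaque J (e y) a b \<longleftrightarrow> same_plaque J (e y') a b"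
        by (rule local_plaques[OF ey(1) ey'(1) z0e z0e'])
      have s1: "slide (e y) (T y) y ?E z0 f1"
        using f1 Tat[OF yL] transverse_disc_at_center transverse_disc_at_topspace
        by (intro plaque_holonomy_imp_slide) auto
      have s2: "slide (e y') ?E z0 (T y') y' f2"
        using f2 Eat transverse_disc_at_center transverse_disc_at_topspace
        by (intro plaque_holonomy_imp_slide) auto
      have "\<forall>\<^sub>F q in nhds_on X (T y) y. same_plaque J (e y) q (f1 q)"
        using s1 by (simp add: slide_def)
      from eventually_compose_filterlim[OF this lim_h]
      have "\<forall>\<^sub>F q in nhds_on X D x. same_plaque J (e y) (h q) (f1 (h q))" .
      moreover have "\<forall>\<^sub>F q in nhds_on X ?E z0. same_plaque J (e y') q (f2 q)"
        using s2 by (simp add: slide_def)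
      from eventually_compose_filterlim[OF this reach_filterlim[OF r1]]
      have "\<forall>\<^sub>F q in nhds_on X D x. same_plaque J (e y') (f1 (h q)) (f2 (f1 (h q)))" by simp
      moreover have "\<forall>\<^sub>F q in nhds_on X D x. (f1 \<circ> h) q \<in> N"
        using eventually_compose_filterlim[OF eventually_on_open[OF N(1,2)] reach_filterlim[OF r1]] .
      moreover note h'(2)
      ultimately have "\<forall>\<^sub>F q in nhds_on X D x. \<forall>z\<in>N \<inter> B y'. same_plaque J (e y) (h q) z \<longrightarrow> z \<in> Q q"
      proof eventually_elim
        case (elim q)
        show ?case
        proof (intro ballI impI)
          fix z assume z: "z \<in> N \<inter> B y'" "same_plaque J (e y) (h q) z"
          have "same_plaque J (e y) (f1 (h q)) z"
            by (rule same_plaque_trans[OF same_plaque_sym[OF elim(1)] z(2)])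
          then have "same_plaque J (e y') (f1 (h q)) z" using N(5) elim(3) z(1) by simp
          then have "same_plaque J (e y') (f2 (f1 (h q))) z"
            by (rule same_plaque_trans[OF same_plaque_sym[OF elim(2)]])
          then have "same_plaque J (e y') (h' q) z" using elim(4) by simp
          then show "z \<in> Q q" using y'(1) h'(1) z(1) unfolding Q_def by blast
        qed
      qed
      then show ?thesis
        using N(1,2) B_open(1)[OF y'L] y'(2) by (intro exI[of _ "N \<inter> B y'"]) auto
    qed
  qed
  \<comment> \<open>Finite holonomy pays off: with finitely many centres and finitely many
    representatives at each, one neighbourhood of \<open>x\<close> in \<open>D\<close> serves them
    all.\<close>
  have "\<forall>\<^sub>F q in nhds_on X D x. \<forall>y\<in>Y. \<forall>h\<in>H y. \<forall>z\<in>K y. same_plaque J (e y) (h q) z \<longrightarrow> z \<in> Q q"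
    by (rule eventually_ball_finite[OF Y(1)], rule ballI, rule eventually_ball_finite[OF H(1)])
      (use closure in auto)
  moreover have "\<forall>\<^sub>F q in nhds_on X D x. q \<in> Q q"
  proof -
    have "T x = D" by (simp add: T_def ex D)
    then obtain h where h: "h \<in> H x" "\<forall>\<^sub>F q in nhds_on X D x. id q = h q"
      using H_rep[OF Y(3), of id] reach_refl[OF Dat] by auto
    have "\<forall>\<^sub>F q in nhds_on X D x. q \<in> B x" using B_open[OF x] by (intro eventually_on_open)
    then show ?thesis using h(2)
    proof eventually_elim
      case (elim q)
      have "same_plaque J (e x) (h q) q"
        using elim same_plaque_refl[of q "e x" J] by (simp add: B_def)
      then show ?case using elim(1) h(1) Y(3) unfolding Q_def by blast
    qed
  qed
  ultimately show ?thesis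
  proof eventually_elim
    case (elim q)
    \<comment> \<open>The rim points contributed by \<open>K y\<close> already lie in
      \<open>Q q\<close>, so one set is both a union of leaf-open pieces and a finite union of
      compact ones. As a clopen set it contains the whole leaf of \<open>q\<close>.\<close>
    have "Q q = (\<Union>y\<in>Y. \<Union>h\<in>H y. K y \<inter> plaque J (e y) (h q))"
    proof (rule equalityI)
      show "Q q \<subseteq> (\<Union>y\<in>Y. \<Union>h\<in>H y. K y \<inter> plaque J (e y) (h q))"
        unfolding Q_def using BK by (intro UN_mono) auto
      show "(\<Union>y\<in>Y. \<Union>h\<in>H y. K y \<inter> plaque J (e y) (h q)) \<subseteq> Q q"
        using elim(1) by auto
    qed
    moreover have "compactin Lt (\<Union>y\<in>Y. \<Union>h\<in>H y. K y \<inter> plaque J (e y) (h q))"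
    proof -
      have piece: "compactin Lt (K y \<inter> plaque J (e y) (h q))" if "y \<in> Y" for y h
        unfolding K_def using that Y(2) by (intro compactin_plaque_piece e r compact_cball) auto
      have "compactin Lt (\<Union>h\<in>H y. K y \<inter> plaque J (e y) (h q))" if "y \<in> Y" for y
        by (rule compactin_Union[OF finite_imageI[OF H(1)[OF that]]]) (use that piece in blast)
      then show ?thesis by (intro compactin_Union[OF finite_imageI[OF Y(1)]]) blast
    qed
    ultimately have Qc: "compactin Lt (Q q)" by simp
    have Qo: "openin Lt (Q q)"
    proof -
      have "openin Lt (B y \<inter> plaque J (e y) (h q))" if "y \<in> Y" for y h
        using that Y(2) by (intro openin_Lt_plaque e(1) B_open(1)) auto
      then have "openin Lt (\<Union>h\<in>H y. B y \<inter> plaque J (e y) (h q))" if "y \<in> Y" for y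
        using that by (intro openin_Union) blast
      then show ?thesis unfolding Q_def by (intro openin_Union) blast
    qed
    have Qcl: "closedin Lt (Q q)"
      using Hausdorff_imp_kc_space[OF Hausdorff_Lt] Qc compactin_imp_closedin_gen by blast
    let ?C = "connected_component_of_set Lt q"
    have qX: "q \<in> topspace Lt" using elim(2) openin_subset[OF Qo] by blast
    then have qC: "q \<in> ?C" by (simp add: connected_component_of_refl)
    then have "?C \<subseteq> Q q"
      using connectedin_clopen_cases[OF connectedin_connected_component_of Qcl Qo, of q] elim(2)
      by (auto simp: disjnt_def)
    then have "compactin Lt ?C"
      by (rule closed_compactin[OF Qc _ closedin_connected_component_of])
    moreover have "?C \<in> leaves X J F"
      using qX by (auto simp: leaves_def connected_components_of_def)
    ultimately have "compact_leaf X J F ?C" by (simp add: compact_leaf_def)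
    then show ?case
      unfolding compact_leaves_union_def by (rule UnionI[OF CollectI qC])
  qed
qed

text \<open>Local stability concerns points of one transverse disc. Leaves are saturated by plaques,
  so all points of the chart that project to the good part of the disc lie on compact leaves too,
  and these fill an open set.\<close>

lemma stable_leaf_imp_positive_measure:
  assumes L: "compact_leaf X J F L" and stable: "stable_leaf X J F L"
  shows "positive_measure X A (\<Omega> X J F)"
proof
  assume "zero_measure X A (\<Omega> X J F)"
  then obtain C where C: "\<And>c. c \<in> C \<Longrightarrow> coordinate_chart X A c" "\<Union> (fst ` C) = topspace X"
    "\<And>c. c \<in> C \<Longrightarrow> snd c ` (fst c \<inter> \<Omega> X J F) \<in> null_sets lebesgue"
    unfolding zero_measure_def by (fastforce simp: case_prod_beta)
  obtain x D where x: "x \<in> L" "transverse_disc_at J F x D" "finite (holonomy_group X J F D x)"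
    using stable by (auto simp: stable_leaf_def)
  then obtain d where d: "d \<in> F" "x \<in> fst d" "D = transverse_disc J d x"
    by (auto simp: transverse_disc_at_def)
  have xX: "x \<in> topspace X" using x(2) by (rule transverse_disc_at_topspace)
  obtain W where W: "openin X W" "x \<in> W" "\<forall>q\<in>W \<inter> D. q \<in> \<Omega> X J F"
    using nearby_leaves_compact[OF L x(1) d x(3)] xX by (auto simp: eventually_nhds_on)
  define N where "N = {q \<in> fst d. proj d x q \<in> W}"
  have N: "openin X N" unfolding N_def by (rule openin_proj_vimage[OF d(1,2) W(1)])
  have xN: "x \<in> N"
    using d W(2) proj_same_plaque[OF d(1) same_plaque_refl[OF d(2)]] by (simp add: N_def)
  have N\<Omega>: "N \<subseteq> \<Omega> X J F"
  proof
    fix q assume q: "q \<in> N"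
    then have qd: "q \<in> fst d" "proj d x q \<in> W" by (auto simp: N_def)
    have "proj d x q \<in> D" unfolding d(3) using d(1) qd(1) d(2) by (rule proj_in_disc)
    then obtain L' where L': "compact_leaf X J F L'" "proj d x q \<in> L'"
      using W(3) qd(2) by (auto simp: compact_leaves_union_def)
    then have "q \<in> L'"
      using leaf_saturated[OF _ L'(2) d(1) same_plaque_sym[OF same_plaque_proj[OF d(1) qd(1) d(2)]]]
      by (simp add: compact_leaf_def)
    then show "q \<in> \<Omega> X J F" using L'(1) by (auto simp: compact_leaves_union_def)
  qed
  \<comment> \<open>The null cover may consist of arbitrary coordinate charts. Being a homeomorphism
    onto an open set, \<open>c\<close> maps the open set \<open>N\<close> to a nonempty open set,
    which is not negligible.\<close>
  obtain c where c: "c \<in> C" "x \<in> fst c" using C(2) xX by blast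
  have ch: "openin X (fst c)" "open (snd c ` fst c)"
    "homeomorphic_map (subtopology X (fst c)) (top_of_set (snd c ` fst c)) (snd c)"
    using C(1)[OF c(1)] by (simp_all add: coordinate_chart_def is_chart_def case_prod_beta)
  have "openin (subtopology X (fst c)) (fst c \<inter> N)"
    using N by (metis inf_commute openin_subtopology_Int)
  then have "openin (top_of_set (snd c ` fst c)) (snd c ` (fst c \<inter> N))"
    using ch(3) by (simp add: homeomorphic_map_openness_eq)
  then have "open (snd c ` (fst c \<inter> N))" using ch(2) openin_open_trans by blast
  moreover have "negligible (snd c ` (fst c \<inter> N))"
    by (rule negligible_subset[OF C(3)[OF c(1), folded negligible_iff_null_sets]]) (use N\<Omega> in auto)
  ultimately show False
    using c(2) xN open_not_negligible by blast
qed

end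

theorem theoremA:
  fixes X :: "'a topology"
    and A F :: "('a, 'n::finite) chart set"
    and J :: "'n set"
  assumes "complex_manifold X A"
    and "compact_space X"
    and "holomorphic_foliation X A J F"
  shows "(\<exists>L. compact_leaf X J F L \<and> stable_leaf X J F L) \<longleftrightarrow> positive_measure X A (\<Omega> X J F)"
proof -
  interpret foliated_manifold X A F J
    using assms by unfold_locales
  show ?thesis
    using stable_leaf_imp_positive_measure positive_measure_imp_stable_leaf by blast
qed

end
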